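(* In the setting described in the context, let $V_0=V_{H,1}+W_H$, and suppose that there is a linear operator $I_0:V_{h,0}\to V_0$ such that, for all $u\in V_{h,0}$, $$\|I_0u\|_{\widetilde a}\le C_0\|u\|_{\widetilde a},$$ $$H^{-2}\int_\Omega\kappa|u-I_0u|^2\,dx\le C_A\,a(u-I_0u,u-I_0u).$$ Assume that $C_0$, $C_A$ and the overlap multiplicity are independent of $h$, $H$ and the contrast $\eta=\kappa_{\max}/\kappa_{\min}$. Then, for every $\Delta t>0$ (the time step entering $\|\cdot\|_{\widetilde a}$, $\widetilde A$ and $\widetilde A_i$), $$\operatorname{cond}\Big(\big(R_0^T\widetilde A_0^{-1}R_0+\sum_{i=1}^NR_i^T\widetilde A_i^{-1}R_i\big)\widetilde A\Big)=O(1),$$ where $\widetilde A=M+\Delta t\,A$ and $\widetilde A_i=M_i+\Delta t\,A_i$ ($i=0,\dots,N$); that is, the condition number (ratio of the largest to the smallest eigenvalue) is bounded by a constant independent of $h$, $H$ and the contrast.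
   Context: **Domain and meshes.** $\Omega\subset\mathbb R^d$ ($d=2,3$) is a bounded domain; $\kappa\in L^\infty(\Omega)$ satisfies $0<\kappa_{\min}\le\kappa\le\kappa_{\max}$, with contrast $\eta=\kappa_{\max}/\kappa_{\min}$. $\mathcal T^h$ is a fine partition with mesh size $h$, $V_h=P_1(\mathcal T^h)$ is the space of continuous piecewise linear functions, and $V_{h,0}=\{v\in V_h: v=0\text{ on }\partial\Omega\}$. $\mathcal T^H$ is a coarse partition of $\Omega$ with mesh size $H$ and elements $K_1,\dots,K_N$. **Forms.** $a(u,v)=\int_\Omega\kappa\nabla u\cdot\nabla v\,dx$, $s(u,v)=H^{-2}\int_\Omega\kappa uv\,dx$, $\|u\|_a^2=a(u,u)$, $\|u\|_s^2=s(u,u)$. For a time step $\Delta t>0$, $\|v\|_{\widetilde a}^2=\Delta t\,a(v,v)+\|v\|_{L^2(\Omega)}^2$. **Auxiliary space.** In each coarse element $K$ there are pairwise disjoint connected open Lipschitz subdomains $K_h^i\subset K$ (high-permeability components), and $K_l=K\setminus\bigcup_iK_h^i$. There are constants $\eta_0,\kappa_0$ with $\max_{K_h^i}\kappa/\min_{K_h^i}\kappa\le\eta_0$, $\min_{K_h^i}\kappa\ge\kappa_0$, $\max_{K_l}\kappa<\kappa_0$, and a constant $C$ independent of $H$ and $K$ with $\int_{K_h^i}|u|^2\le CH^2\int_{K_h^i}|\nabla u|^2$ whenever $\int_{K_h^i}u=0$. $V_{\mathrm{aux},1}$ is the span of the characteristic functions of all $K_h^i$ (over all $K$), $V_{\mathrm{aux},2}$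 the span of the characteristic functions of all $K_l$, $V_{\mathrm{aux}}=V_{\mathrm{aux},1}+V_{\mathrm{aux},2}$, and $\pi$ is the $s$-orthogonal projection onto $V_{\mathrm{aux}}$. **Coarse space.** For $\psi\in V_{\mathrm{aux}}$ let $\phi_\psi\in V_{h,0}$ solve $a(\phi_\psi,v)+s(\pi\phi_\psi,\pi v)=s(\psi,\pi v)$ for all $v\in V_{h,0}$. Then $V_{H,1}=\{\phi_\psi:\psi\in V_{\mathrm{aux},1}\}$. $W_H\subset V_{h,0}$ is an additional coarse subspace (for example a standard or multiscale finite element space on $\mathcal T^H$). **Overlapping subdomains.** $\omega_i$ is obtained by extending $K_i$ by layers of fine elements; $\Omega=\bigcup_i\omega_i$; the overlap multiplicity is the maximal number of $\omega_i$ containing a common point. $V_i=V_{h,0}(\omega_i)$ ($i\ge1$) is the space of fine finite element functions on $\omega_i$ vanishing on $\partial\omega_i$. There is a partition of unity $\{\chi_i\}\subset V_h$ with $\chi_i$ supported in $\omega_i$, $\sum_i\chi_i=1$, $\sum_i\chi_i^2\le1$, $|\nabla\chi_i|\le CH^{-1}$. The fine nodal interpolant $I_h$ satisfies $\|I_hv\|_a\le C_I\|v\|_a$ and $\|I_hv\|_s\le C_I\|v\|_s$ for all continuous $v$ that are piecewise quadratic on $\mathcal T^h$, with $C_I$ independent of $h,H,\eta$. **Matrices.** $A$ and $M$ are the fine-grid stiffness matrix (of $a$) and mass matrix (of the $L^2(\Omega)$ inner product) on $V_{h,0}$. $R_i^T:V_i\to V_{h,0}$ is the matrix of the extension by zero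 for $i\ge1$ and of the inclusion $V_0\subset V_{h,0}$ for $i=0$ (in terms of a basis of $V_0$); $A_i=R_iAR_i^T$, $M_i=R_iMR_i^T$ for $i=0,\dots,N$. *)

theory Defs
  imports
    "HOL-Analysis.Analysis"
    "HOL-Probability.Essential_Supremum"
    "HOL-Library.Function_Algebras"
    "Jordan_Normal_Form.Spectral_Radius"
begin

abbreviation (input) fscale :: "real \<Rightarrow> ('a \<Rightarrow> real) \<Rightarrow> 'a \<Rightarrow> real" where
  "fscale c f \<equiv> (\<lambda>x. c * f x)"

interpretation fun_vs: vector_space fscale
  by unfold_locales (auto simp: fun_eq_iff algebra_simps)

definition fsum :: "('a \<Rightarrow> real) set \<Rightarrow> ('a \<Rightarrow> real) set \<Rightarrow> ('a \<Rightarrow> real) set" where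
  "fsum V W = {f + g |f g. f \<in> V \<and> g \<in> W}"

definition is_basis :: "('a \<Rightarrow> real) list \<Rightarrow> ('a \<Rightarrow> real) set \<Rightarrow> bool" where
  "is_basis bs V \<longleftrightarrow>
     distinct bs \<and> \<not> fun_vs.dependent (set bs) \<and> fun_vs.span (set bs) = V"

definition linear_operator ::
    "('a \<Rightarrow> real) set \<Rightarrow> ('a \<Rightarrow> real) set \<Rightarrow> (('a \<Rightarrow> real) \<Rightarrow> 'a \<Rightarrow> real) \<Rightarrow> bool" where
  "linear_operator V W L \<longleftrightarrow>
     (\<forall>u\<in>V. L u \<in> W) \<and>
     (\<forall>u\<in>V. \<forall>v\<in>V. L (u + v) = L u + L v) \<and>
     (\<forall>c. \<forall>u\<in>V. L (fscale c u) = fscale c (L u))"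

definition form_norm :: "(('a \<Rightarrow> real) \<Rightarrow> ('a \<Rightarrow> real) \<Rightarrow> real) \<Rightarrow> ('a \<Rightarrow> real) \<Rightarrow> real" where
  "form_norm b u = sqrt (b u u)"

text \<open>Classical gradient. It is only used under integrals or almost everywhere, for functions
  that are polynomial on each fine element and hence differentiable off a null set; where the
  function is not differentiable the value is arbitrary.\<close>

definition grad :: "((real ^ 'd) \<Rightarrow> real) \<Rightarrow> real ^ 'd \<Rightarrow> real ^ 'd" where
  "grad u x = (SOME D. GDERIV u x :> D)"

text \<open>Continuously differentiable functions with compact support in \<open>S\<close>; testing with these
  yields the same weak gradients as testing with smooth functions.\<close>

definition test_function :: "(real ^ 'd) set \<Rightarrow> ((real ^ 'd) \<Rightarrow> real) \<Rightarrow> bool" where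
  "test_function S \<phi> \<longleftrightarrow>
     (\<forall>x. GDERIV \<phi> x :> grad \<phi> x) \<and> continuous_on UNIV (grad \<phi>) \<and>
     (\<exists>C. compact C \<and> C \<subseteq> S \<and> (\<forall>x. x \<notin> C \<longrightarrow> \<phi> x = 0))"

definition H1_with_gradient ::
    "(real ^ 'd) set \<Rightarrow> ((real ^ 'd) \<Rightarrow> real) \<Rightarrow> ((real ^ 'd) \<Rightarrow> real ^ 'd) \<Rightarrow> bool" where
  "H1_with_gradient S u g \<longleftrightarrow>
     u \<in> borel_measurable (lebesgue_on S) \<and> integrable (lebesgue_on S) (\<lambda>x. (u x)\<^sup>2) \<and>
     g \<in> borel_measurable (lebesgue_on S) \<and> integrable (lebesgue_on S) (\<lambda>x. (norm (g x))\<^sup>2) \<and>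
     (\<forall>\<phi>. test_function S \<phi> \<longrightarrow>
        (LINT x|lebesgue_on S. u x *\<^sub>R grad \<phi> x) = - (LINT x|lebesgue_on S. \<phi> x *\<^sub>R g x))"

text \<open>Near each boundary point, \<open>S\<close> is the strict epigraph, in some unit direction \<open>e\<close>, of a
  Lipschitz function of the component orthogonal to \<open>e\<close>.\<close>

definition lipschitz_domain :: "(real ^ 'd) set \<Rightarrow> bool" where
  "lipschitz_domain S \<longleftrightarrow>
     open S \<and> bounded S \<and>
     (\<forall>p\<in>frontier S. \<exists>e r L \<gamma>. norm e = 1 \<and> 0 < r \<and> lipschitz_on L UNIV (\<gamma> :: real ^ 'd \<Rightarrow> real) \<and>
        S \<inter> ball p r = {x \<in> ball p r. \<gamma> (x - inner x e *\<^sub>R e) < inner x e})"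

definition ess_max :: "((real ^ 'd) \<Rightarrow> real) \<Rightarrow> (real ^ 'd) set \<Rightarrow> ereal" where
  "ess_max f S = esssup (lebesgue_on S) (\<lambda>x. ereal (f x))"

definition ess_min :: "((real ^ 'd) \<Rightarrow> real) \<Rightarrow> (real ^ 'd) set \<Rightarrow> ereal" where
  "ess_min f S = - esssup (lebesgue_on S) (\<lambda>x. - ereal (f x))"

text \<open>Finite element functions live on \<open>\<Union>\<T>\<close>; they are extended by zero to the whole space so
  that equality of functions is equality on the mesh.\<close>

definition P1 :: "(real ^ 'd) set set \<Rightarrow> ((real ^ 'd) \<Rightarrow> real) set" where
  "P1 \<T> = {v. continuous_on (\<Union>\<T>) v \<and>
              (\<forall>T\<in>\<T>. \<exists>b c. \<forall>x\<in>T. v x = inner b x + c) \<and>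
              (\<forall>x. x \<notin> \<Union>\<T> \<longrightarrow> v x = 0)}"

definition P2 :: "(real ^ 'd) set set \<Rightarrow> ((real ^ 'd) \<Rightarrow> real) set" where
  "P2 \<T> = {v. continuous_on (\<Union>\<T>) v \<and>
              (\<forall>T\<in>\<T>. \<exists>Q b c. \<forall>x\<in>T. v x = inner x (Q *v x) + inner b x + c)}"

definition vertices :: "(real ^ 'd) set set \<Rightarrow> (real ^ 'd) set" where
  "vertices \<T> = {x. \<exists>T\<in>\<T>. x extreme_point_of T}"

definition nodal_interpolant :: "(real ^ 'd) set set \<Rightarrow> ((real ^ 'd) \<Rightarrow> real) \<Rightarrow> (real ^ 'd) \<Rightarrow> real" where
  "nodal_interpolant \<T> f = (THE w. w \<in> P1 \<T> \<and> (\<forall>q\<in>vertices \<T>. w q = f q))"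

definition nodal_basis_fun :: "(real ^ 'd) set set \<Rightarrow> real ^ 'd \<Rightarrow> (real ^ 'd) \<Rightarrow> real" where
  "nodal_basis_fun \<T> p = nodal_interpolant \<T> (\<lambda>q. if q = p then 1 else 0)"

definition add_layer :: "(real ^ 'd) set set \<Rightarrow> (real ^ 'd) set set \<Rightarrow> (real ^ 'd) set set" where
  "add_layer \<T> \<S> = {T \<in> \<T>. T \<inter> \<Union>\<S> \<noteq> {}}"

text \<open>Coarse elements, high-permeability components, layer numbers and partition of unity
  functions are indexed by \<open>i \<in> {1..N}\<close>. The coarse element \<open>K\<^sub>i\<close> is given as the set of fine elements
  it consists of, and \<open>channels i\<close> is the set of the components \<open>K\<^sub>h\<^sup>j\<close> of \<open>K = K\<^sub>i\<close>.\<close>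

record 'a two_level =
  \<Omega> :: "'a set"
  \<kappa> :: "'a \<Rightarrow> real"
  \<kappa>_min :: real
  \<kappa>_max :: real
  fine_elems :: "'a set set"
  N :: nat
  coarse_elems :: "nat \<Rightarrow> 'a set set"
  channels :: "nat \<Rightarrow> 'a set set"
  \<kappa>_thr :: real
  layers :: "nat \<Rightarrow> nat"
  pou :: "nat \<Rightarrow> 'a \<Rightarrow> real"
  W_H :: "('a \<Rightarrow> real) set"

context
  fixes P :: "(real ^ 'd) two_level"
begin

definition coarse_elem :: "nat \<Rightarrow> (real ^ 'd) set" where
  "coarse_elem i = \<Union>(coarse_elems P i)"

definition coarse_size :: real where
  "coarse_size = Max ((\<lambda>i. diameter (coarse_elem i)) ` {1..N P})"

definition low_part :: "nat \<Rightarrow> (real ^ 'd) set" where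
  "low_part i = coarse_elem i - \<Union>(channels P i)"

definition V_h :: "((real ^ 'd) \<Rightarrow> real) set" where
  "V_h = P1 (fine_elems P)"

definition V_h0 :: "((real ^ 'd) \<Rightarrow> real) set" where
  "V_h0 = {v \<in> V_h. \<forall>x\<in>frontier (\<Omega> P). v x = 0}"

definition a_form :: "((real ^ 'd) \<Rightarrow> real) \<Rightarrow> ((real ^ 'd) \<Rightarrow> real) \<Rightarrow> real" where
  "a_form u v = (LINT x|lebesgue_on (\<Omega> P). \<kappa> P x * inner (grad u x) (grad v x))"

definition s_form :: "((real ^ 'd) \<Rightarrow> real) \<Rightarrow> ((real ^ 'd) \<Rightarrow> real) \<Rightarrow> real" where
  "s_form u v = (LINT x|lebesgue_on (\<Omega> P). \<kappa> P x * (u x * v x)) / coarse_size\<^sup>2"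

definition L2_form :: "((real ^ 'd) \<Rightarrow> real) \<Rightarrow> ((real ^ 'd) \<Rightarrow> real) \<Rightarrow> real" where
  "L2_form u v = (LINT x|lebesgue_on (\<Omega> P). u x * v x)"

definition at_form :: "real \<Rightarrow> ((real ^ 'd) \<Rightarrow> real) \<Rightarrow> ((real ^ 'd) \<Rightarrow> real) \<Rightarrow> real" where
  "at_form dt u v = dt * a_form u v + L2_form u v"

definition V_aux1 :: "((real ^ 'd) \<Rightarrow> real) set" where
  "V_aux1 = fun_vs.span {indicator S |S i. i \<in> {1..N P} \<and> S \<in> channels P i}"

definition V_aux2 :: "((real ^ 'd) \<Rightarrow> real) set" where
  "V_aux2 = fun_vs.span {indicator (low_part i) |i. i \<in> {1..N P}}"

definition V_aux :: "((real ^ 'd) \<Rightarrow> real) set" where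
  "V_aux = fsum V_aux1 V_aux2"

text \<open>The \<open>s\<close>-orthogonal projection onto \<open>V_aux\<close>. It is unique up to null sets, which does not
  affect \<^const>\<open>s_form\<close>.\<close>

definition aux_proj :: "((real ^ 'd) \<Rightarrow> real) \<Rightarrow> (real ^ 'd) \<Rightarrow> real" where
  "aux_proj u = (SOME p. p \<in> V_aux \<and> (\<forall>q\<in>V_aux. s_form (u - p) q = 0))"

definition solves_coarse :: "((real ^ 'd) \<Rightarrow> real) \<Rightarrow> ((real ^ 'd) \<Rightarrow> real) \<Rightarrow> bool" where
  "solves_coarse \<psi> \<phi> \<longleftrightarrow>
     \<phi> \<in> V_h0 \<and>
     (\<forall>v\<in>V_h0. a_form \<phi> v + s_form (aux_proj \<phi>) (aux_proj v) = s_form \<psi> (aux_proj v))"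

definition V_H1 :: "((real ^ 'd) \<Rightarrow> real) set" where
  "V_H1 = {\<phi>. \<exists>\<psi>\<in>V_aux1. solves_coarse \<psi> \<phi>}"

definition V_0 :: "((real ^ 'd) \<Rightarrow> real) set" where
  "V_0 = fsum V_H1 (W_H P)"

definition \<omega> :: "nat \<Rightarrow> (real ^ 'd) set" where
  "\<omega> i = interior (\<Union>((add_layer (fine_elems P) ^^ layers P i) (coarse_elems P i)))"

definition overlap :: nat where
  "overlap = Max ((\<lambda>x. card {i \<in> {1..N P}. x \<in> \<omega> i}) ` \<Omega> P)"

text \<open>Elements of \<open>V_i\<close> for \<open>i \<ge> 1\<close> are stored already extended by zero outside \<open>\<omega> i\<close>.\<close>

definition V_sub :: "nat \<Rightarrow> ((real ^ 'd) \<Rightarrow> real) set" where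
  "V_sub i = (if i = 0 then V_0 else {v \<in> V_h. \<forall>x. x \<notin> \<omega> i \<longrightarrow> v x = 0})"

end

locale two_level_setting =
  fixes \<eta>\<^sub>0 C\<^sub>P C\<^sub>I C\<^sub>\<chi> :: real and m :: nat
    and P :: "(real ^ 'd) two_level"
  assumes domain: "open (\<Omega> P)" "connected (\<Omega> P)" "bounded (\<Omega> P)" "\<Omega> P \<noteq> {}"
    and coefficient:
      "\<kappa> P \<in> borel_measurable (lebesgue_on (\<Omega> P))"
      "0 < \<kappa>_min P"
      "AE x in lebesgue_on (\<Omega> P). \<kappa>_min P \<le> \<kappa> P x \<and> \<kappa> P x \<le> \<kappa>_max P"
    and fine_mesh:
      "triangulation (fine_elems P)"
      "\<forall>T\<in>fine_elems P. int CARD('d) simplex T"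
      "\<Omega> P = interior (\<Union>(fine_elems P))"
    and coarse_mesh:
      "\<forall>i\<in>{1..N P}. coarse_elems P i \<noteq> {}"
      "disjoint_family_on (coarse_elems P) {1..N P}"
      "(\<Union>i\<in>{1..N P}. coarse_elems P i) = fine_elems P"
    and channels:
      "\<forall>i\<in>{1..N P}. finite (channels P i) \<and> disjoint (channels P i)"
      "\<forall>i\<in>{1..N P}. \<forall>S\<in>channels P i.
         S \<noteq> {} \<and> connected S \<and> lipschitz_domain S \<and> S \<subseteq> coarse_elem P i"
      "\<forall>i\<in>{1..N P}. \<forall>S\<in>channels P i.
         ess_max (\<kappa> P) S / ess_min (\<kappa> P) S \<le> ereal \<eta>\<^sub>0 \<and> ereal (\<kappa>_thr P) \<le> ess_min (\<kappa> P) S"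
      "\<forall>i\<in>{1..N P}. ess_max (\<kappa> P) (low_part P i) < ereal (\<kappa>_thr P)"
    and poincare:
      "\<forall>i\<in>{1..N P}. \<forall>S\<in>channels P i. \<forall>u g.
         H1_with_gradient S u g \<and> (LINT x|lebesgue_on S. u x) = 0 \<longrightarrow>
         (LINT x|lebesgue_on S. (u x)\<^sup>2)
           \<le> C\<^sub>P * (coarse_size P)\<^sup>2 * (LINT x|lebesgue_on S. (norm (g x))\<^sup>2)"
    and extra_coarse: "W_H P \<subseteq> V_h0 P" "fun_vs.subspace (W_H P)"
    and overlapping:
      "\<forall>i\<in>{1..N P}. 1 \<le> layers P i"
      "\<Omega> P = (\<Union>i\<in>{1..N P}. \<omega> P i)"
      "overlap P \<le> m"
    and partition_of_unity:
      "\<forall>i\<in>{1..N P}. pou P i \<in> V_h P \<and> (\<forall>x\<in>\<Omega> P - \<omega> P i. pou P i x = 0)"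
      "\<forall>x\<in>closure (\<Omega> P). (\<Sum>i\<in>{1..N P}. pou P i x) = 1"
      "\<forall>x\<in>closure (\<Omega> P). (\<Sum>i\<in>{1..N P}. (pou P i x)\<^sup>2) \<le> 1"
      "\<forall>i\<in>{1..N P}. AE x in lebesgue_on (\<Omega> P). norm (grad (pou P i) x) \<le> C\<^sub>\<chi> / coarse_size P"
    and interpolation:
      "\<forall>v\<in>P2 (fine_elems P).
         form_norm (a_form P) (nodal_interpolant (fine_elems P) v) \<le> C\<^sub>I * form_norm (a_form P) v \<and>
         form_norm (s_form P) (nodal_interpolant (fine_elems P) v) \<le> C\<^sub>I * form_norm (s_form P) v"

definition gram :: "(('a \<Rightarrow> real) \<Rightarrow> ('a \<Rightarrow> real) \<Rightarrow> real) \<Rightarrow> ('a \<Rightarrow> real) list \<Rightarrow> real mat" where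
  "gram b \<Phi> = Matrix.mat (length \<Phi>) (length \<Phi>) (\<lambda>(k, l). b (\<Phi> ! l) (\<Phi> ! k))"

text \<open>Matrix, in nodal coordinates, of the inclusion of the space with basis \<open>bs\<close>: the coordinates
  of a function with respect to the nodal basis of \<open>V_h0\<close> are its values at the interior vertices \<open>ps\<close>.\<close>

definition inclusion_mat :: "'a list \<Rightarrow> ('a \<Rightarrow> real) list \<Rightarrow> real mat" where
  "inclusion_mat ps bs = Matrix.mat (length ps) (length bs) (\<lambda>(k, j). (bs ! j) (ps ! k))"

definition is_interior_vertex_list :: "(real ^ 'd) two_level \<Rightarrow> (real ^ 'd) list \<Rightarrow> bool" where
  "is_interior_vertex_list P ps \<longleftrightarrow> distinct ps \<and> set ps = vertices (fine_elems P) \<inter> \<Omega> P"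

definition stiffness :: "(real ^ 'd) two_level \<Rightarrow> (real ^ 'd) list \<Rightarrow> real mat" where
  "stiffness P ps = gram (a_form P) (map (nodal_basis_fun (fine_elems P)) ps)"

definition mass :: "(real ^ 'd) two_level \<Rightarrow> (real ^ 'd) list \<Rightarrow> real mat" where
  "mass P ps = gram (L2_form P) (map (nodal_basis_fun (fine_elems P)) ps)"

definition subspace_solve :: "real \<Rightarrow> real mat \<Rightarrow> real mat \<Rightarrow> real mat \<Rightarrow> real mat" where
  "subspace_solve dt M A RT =
     (let R = transpose_mat RT;
          M' = R * M * RT;
          A' = R * A * RT
      in RT * the (mat_inverse (M' + dt \<cdot>\<^sub>m A')) * R)"

definition preconditioner ::
    "(real ^ 'd) two_level \<Rightarrow> real \<Rightarrow> (real ^ 'd) list \<Rightarrow> (nat \<Rightarrow> ((real ^ 'd) \<Rightarrow> real) list) \<Rightarrow> real mat" where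
  "preconditioner P dt ps bs =
     (let n = length ps;
          B = (\<lambda>i. subspace_solve dt (mass P ps) (stiffness P ps) (inclusion_mat ps (bs i)))
      in B 0 + Matrix.mat n n (\<lambda>(k, l). \<Sum>i\<in>{1..N P}. B i $$ (k, l)))"

text \<open>Ratio of the largest to the smallest (real) eigenvalue; the empty matrix, which has no
  eigenvalues, gets condition number 1.\<close>

definition cond :: "real mat \<Rightarrow> real" where
  "cond B = (if dim_row B = 0 then 1 else Max (spectrum B) / Min (spectrum B))"

end

theory Submission
  imports Defs
begin

text \<open>The preconditioned operator is the sum \<open>\<Sum>\<^sub>i P\<^sub>i\<close> of the projections onto the subspaces \<open>V\<^sub>i\<close> that
  are orthogonal in \<open>b u v = \<Delta>t a(u, v) + (u, v)\<close>; it is \<open>b\<close>-selfadjoint, so that its spectrum lies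
  between the bounds of the quotient \<open>\<Sum>\<^sub>i b (P\<^sub>i u) (P\<^sub>i u) / b u u\<close>. Since every point lies in at most
  \<open>m\<close> of the subdomains, the quotient is at most \<open>m + 1\<close>. For the lower bound decompose
  \<open>u = I\<^sub>0 u + \<Sum>\<^sub>i I\<^sub>h (\<chi>\<^sub>i w)\<close> with \<open>w = u - I\<^sub>0 u\<close>. The energy of \<open>\<chi>\<^sub>i w\<close> is controlled by the product rule,
  the bound on \<open>\<nabla>\<chi>\<^sub>i\<close> and the approximation property of \<open>I\<^sub>0\<close>. For the unweighted \<open>L\<^sup>2\<close> part no interpolation
  bound is assumed; it follows element by element, because the square of an affine function
  integrates to at least a fixed fraction of the volume times its maximum on any convex body.\<close>

section \<open>Piecewise affine functions on a triangulation\<close>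

text \<open>The contrast cannot enter because \<open>\<kappa>\<close> stays under the integrals as a
  pointwise weight; its bounds serve only for signs and integrability. Independence of the time step
  comes from estimating the \<open>a_form\<close> part and the \<open>L2_form\<close> part of the
  local pieces separately, so that neither is traded for the other. Interpolation enters because a
  cut-off times \<open>w\<close> is piecewise quadratic and leaves the fine space. It creates the
  geometric obstacle of the proof: \<open>\<omega> P i\<close> is the interior of a union of
  elements, and a fine function that is zero at all vertices outside this set has to be shown zero
  at every point outside. The lower bound is Lions' argument: a single decomposition of
  \<open>u\<close> with total energy at most \<open>C * b u u\<close>, tested against the
  projections, yields \<open>b u u\<close> at most \<open>C\<close> times the sum of the projection
  energies. Finally, \<open>cond\<close> reads real eigenvalues only. The complex spectrum is
  therefore shown to be real and positive as well, which also ensures that real eigenvalues exist at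
  all.\<close>

lemma triangulation_interiors_disjoint:
  assumes "triangulation \<T>"
    and "T \<in> \<T>" "T' \<in> \<T>" "T \<noteq> T'"
  shows "interior T \<inter> interior T' = ({} :: 'a::euclidean_space set)"
proof (rule ccontr)
  assume ne: "interior T \<inter> interior T' \<noteq> {}"
  have "(T \<inter> T') face_of T" "(T' \<inter> T) face_of T'"
    using assms(1-3) by (auto simp: triangulation_def)
  then have "(T \<inter> T') face_of T" "(T \<inter> T') face_of T'" by (simp_all add: Int_commute)
  moreover have "T \<inter> T' \<noteq> T \<or> T \<inter> T' \<noteq> T'" using assms(4) by auto
  ultimately show False
    using ne face_of_disjoint_interior[of "T \<inter> T'" T] face_of_disjoint_interior[of "T \<inter> T'" T'] interior_subset
    by blast
qed

text \<open>The extreme points are affinely independent, so their differences to one of them,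
  \<open>p0\<close>, are linearly independent and a linear functional can take prescribed values
  there; \<open>b\<close> is its representing vector.\<close>

lemma simplex_affine_interpolation:
  fixes T :: "'a::euclidean_space set"
  assumes "n simplex T"
  obtains b c where "\<And>p. p extreme_point_of T \<Longrightarrow> inner b p + c = f p"
proof -
  obtain C where C: "\<not> affine_dependent C" "T = convex hull C"
    using assms by (auto simp: simplex_def)
  have ext: "{p. p extreme_point_of T} = C"
    using C extreme_point_of_convex_hull_affine_independent by blast
  show thesis
  proof (cases "C = {}")
    case True
    then show ?thesis using that[of 0 0] ext by auto
  next
    case False
    then obtain p0 where p0: "p0 \<in> C" by auto
    have "(\<lambda>p. p - p0) = (\<lambda>p. - p0 + p)" by auto
    then have ind: "independent ((\<lambda>p. p - p0) ` (C - {p0}))"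
      using C(1) affine_dependent_iff_dependent2[OF p0] by metis
    obtain g :: "'a \<Rightarrow> real" where g: "linear g"
       "\<forall>y\<in>(\<lambda>p. p - p0) ` (C - {p0}). g y = f (y + p0) - f p0"
      using linear_independent_extend[OF ind, of "\<lambda>y. f (y + p0) - f p0"] by blast
    define b where "b = (\<Sum>i\<in>Basis. g i *\<^sub>R i)"
    have gb: "g x = inner b x" for x
    proof -
      have "g x = g (\<Sum>i\<in>Basis. inner x i *\<^sub>R i)" by (simp add: euclidean_representation)
      also have "\<dots> = (\<Sum>i\<in>Basis. inner x i * g i)" by (simp add: linear_sum[OF g(1)] linear_cmul[OF g(1)])
      finally show ?thesis unfolding b_def inner_sum_left by (simp add: inner_commute mult.commute)
    qed
    show ?thesis
    proof (rule that[of b "f p0 - inner b p0"])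
      fix p assume "p extreme_point_of T"
      then have "p \<in> C" using ext by auto
      then show "inner b p + (f p0 - inner b p0) = f p"
        using g(2)[rule_format, of "p - p0"] unfolding gb by (cases "p = p0") (simp_all add: inner_diff_right)
    qed
  qed
qed

text \<open>The set where two affine functions agree is convex, and a compact convex set is the hull
  of its extreme points.\<close>

lemma affine_eqI_extreme_points:
  fixes S :: "'a::euclidean_space set"
  assumes "compact S" "convex S" "x \<in> S"
    and "\<And>p. p extreme_point_of S \<Longrightarrow> inner b p + c = inner b' p + c'"
  shows "inner b x + c = inner b' x + c'"
proof -
  have "{p. inner b p + c = inner b' p + c'} = {p. inner (b - b') p = c' - c}"
    by (auto simp: inner_diff_left)
  then have "convex {p. inner b p + c = inner b' p + c'}" by (simp add: convex_hyperplane)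
  then have "convex hull {p. p extreme_point_of S} \<subseteq> {p. inner b p + c = inner b' p + c'}"
    using assms(4) by (intro hull_minimal) auto
  then show ?thesis using Krein_Milman_Minkowski[OF assms(1,2)] assms(3) by auto
qed

lemma simplex_compact_convex:
  assumes "n simplex T" shows "compact T" "convex T" "polytope T"
  using assms compact_simplex simplex_imp_polytope convex_simplex by blast+

lemma P1_affine:
  fixes \<T> :: "(real ^ 'd) set set"
  shows "v \<in> P1 \<T> \<Longrightarrow> T \<in> \<T> \<Longrightarrow> \<exists>b c. \<forall>x\<in>T. v x = inner b x + c"
  by (simp add: P1_def)

lemma P1_ext:
  fixes \<T> :: "(real ^ 'd) set set"
  assumes "triangulation \<T>" "v \<in> P1 \<T>" "w \<in> P1 \<T>" "\<And>q. q \<in> vertices \<T> \<Longrightarrow> v q = w q"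
  shows "v = w"
proof
  fix x
  show "v x = w x"
  proof (cases "x \<in> \<Union>\<T>")
    case True
    then obtain T where T: "T \<in> \<T>" "x \<in> T" by auto
    obtain n where n: "n simplex T" using assms(1) T by (auto simp: triangulation_def)
    obtain b c where bc1: "\<forall>x\<in>T. v x = inner b x + c" using P1_affine[OF assms(2) T(1)] by blast
    obtain b' c' where bc2: "\<forall>x\<in>T. w x = inner b' x + c'" using P1_affine[OF assms(3) T(1)] by blast
    have "inner b x + c = inner b' x + c'"
    proof (rule affine_eqI_extreme_points[OF simplex_compact_convex(1,2)[OF n] T(2)])
      fix p assume p: "p extreme_point_of T"
      then have "p \<in> T" "p \<in> vertices \<T>" using T by (auto simp: extreme_point_of_def vertices_def)
      then show "inner b p + c = inner b' p + c'" using bc1 bc2 assms(4) by metis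
    qed
    then show ?thesis using bc1 bc2 T by metis
  next
    case False
    then show ?thesis using assms(2,3) by (auto simp: P1_def)
  qed
qed

text \<open>The affine interpolants of two elements fit together: the intersection of the elements
  is a face of both, so its extreme points are extreme points of both, where both interpolants take
  the value of \<open>f\<close>. Continuity then follows from the finite closed cover by
  elements.\<close>

lemma P1_interpolant_exists:
  fixes \<T> :: "(real ^ 'd) set set"
  assumes tri: "triangulation \<T>"
  shows "\<exists>w. w \<in> P1 \<T> \<and> (\<forall>q\<in>vertices \<T>. w q = f q)"
proof -
  have "\<exists>b c. \<forall>p. p extreme_point_of T \<longrightarrow> inner b p + c = f p" if "T \<in> \<T>" for T
    using that tri simplex_affine_interpolation unfolding triangulation_def by metis
  then obtain b c where bc: "\<And>T p. T \<in> \<T> \<Longrightarrow> p extreme_point_of T \<Longrightarrow> inner (b T) p + c T = f p"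
    by metis
  have cc: "compact T" "convex T" if "T \<in> \<T>" for T
    using that tri simplex_compact_convex unfolding triangulation_def by blast+
  have agree: "inner (b T) x + c T = inner (b T') x + c T'"
    if "T \<in> \<T>" "T' \<in> \<T>" "x \<in> T" "x \<in> T'" for T T' x
  proof (rule affine_eqI_extreme_points[of "T \<inter> T'"])
    show "compact (T \<inter> T')" "convex (T \<inter> T')" using that cc by (auto intro: convex_Int)
    show "x \<in> T \<inter> T'" using that by auto
    fix p assume p: "p extreme_point_of (T \<inter> T')"
    have "(T \<inter> T') face_of T" "(T' \<inter> T) face_of T'"
      using tri that by (auto simp: triangulation_def)
    then have "(T \<inter> T') face_of T" "(T \<inter> T') face_of T'" by (simp_all add: Int_commute)
    then show "inner (b T) p + c T = inner (b T') p + c T'"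
      using p bc that extreme_point_of_face by metis
  qed
  have "\<forall>x\<in>\<Union>\<T>. \<exists>T. T \<in> \<T> \<and> x \<in> T" by blast
  then obtain sel where sel: "\<And>x. x \<in> \<Union>\<T> \<Longrightarrow> sel x \<in> \<T> \<and> x \<in> sel x" by metis
  define w where "w x = (if x \<in> \<Union>\<T> then inner (b (sel x)) x + c (sel x) else 0)" for x
  have w: "w x = inner (b T) x + c T" if "T \<in> \<T>" "x \<in> T" for x T
  proof -
    have x: "x \<in> \<Union>\<T>" using that by blast
    then have "w x = inner (b (sel x)) x + c (sel x)" by (simp only: w_def if_True)
    then show ?thesis using agree[of "sel x" T x] sel[OF x] that by simp
  qed
  have "continuous_on (\<Union>\<T>) w"
  proof -
    have "continuous_on (\<Union>T\<in>\<T>. T) w"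
    proof (rule continuous_on_closed_Union)
      show "finite \<T>" using tri by (simp add: triangulation_def)
      fix T assume T: "T \<in> \<T>"
      then show "closed T" using cc compact_imp_closed by auto
      have "continuous_on T (\<lambda>x. inner (b T) x + c T)" by (intro continuous_intros)
      then show "continuous_on T w" using w[OF T] by (simp cong: continuous_on_cong)
    qed
    then show ?thesis by simp
  qed
  moreover have "\<forall>T\<in>\<T>. \<exists>b c. \<forall>x\<in>T. w x = inner b x + c" using w by blast
  moreover have "w q = f q" if q: "q \<in> vertices \<T>" for q
  proof -
    obtain T where T: "T \<in> \<T>" "q extreme_point_of T" using q by (auto simp: vertices_def)
    then have "q \<in> T" by (auto simp: extreme_point_of_def)
    then show ?thesis using w bc T by metis
  qed
  ultimately show ?thesis by (intro exI[of _ w]) (auto simp: P1_def w_def)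
qed

lemma
  fixes \<T> :: "(real ^ 'd) set set"
  assumes tri: "triangulation \<T>"
  shows nodal_interpolant_P1: "nodal_interpolant \<T> f \<in> P1 \<T>"
    and nodal_interpolant_vertex: "\<And>q. q \<in> vertices \<T> \<Longrightarrow> nodal_interpolant \<T> f q = f q"
proof -
  have "\<exists>!w. w \<in> P1 \<T> \<and> (\<forall>q\<in>vertices \<T>. w q = f q)"
    using P1_interpolant_exists[OF tri] P1_ext[OF tri] by (metis (no_types, lifting))
  from theI'[OF this] show "nodal_interpolant \<T> f \<in> P1 \<T>" "\<And>q. q \<in> vertices \<T> \<Longrightarrow> nodal_interpolant \<T> f q = f q"
    unfolding nodal_interpolant_def by auto
qed

text \<open>Contracting \<open>T\<close> towards \<open>q\<close> does not change the constraints active at \<open>q\<close>, and the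
  inactive ones are strict at \<open>x\<close>.\<close>

lemma polytope_eventually_scaling:
  fixes T :: "'a::euclidean_space set"
  assumes "polytope T" "q \<in> T" "z \<in> T" "0 < l" "l \<le> 1" "x = l *\<^sub>R q + (1 - l) *\<^sub>R z" "0 < t"
  shows "\<forall>\<^sub>F y in nhds x. q + t *\<^sub>R (y - q) \<in> T \<longrightarrow> y \<in> T"
proof -
  obtain F where F: "finite F" "T = \<Inter>F" "\<And>h. h \<in> F \<Longrightarrow> \<exists>a b. a \<noteq> 0 \<and> h = {x. inner a x \<le> b}"
    using polytope_imp_polyhedron[OF assms(1)] unfolding polyhedron_def by blast
  have "\<forall>\<^sub>F y in nhds x. q + t *\<^sub>R (y - q) \<in> h \<longrightarrow> y \<in> h" if hF: "h \<in> F" for h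
  proof -
    obtain a b where h: "h = {x. inner a x \<le> b}" using F(3)[OF hF] by blast
    have q: "inner a q \<le> b" and z: "inner a z \<le> b" using assms(2,3) F(2) hF h by auto
    show ?thesis
    proof (cases "inner a q = b")
      case True
      have "y \<in> h" if "q + t *\<^sub>R (y - q) \<in> h" for y
      proof -
        have "t * (inner a y - inner a q) \<le> 0" using that True by (simp add: h inner_add_right inner_diff_right)
        then show ?thesis using \<open>0 < t\<close> True by (simp add: h mult_le_0_iff)
      qed
      then show ?thesis by simp
    next
      case False
      then have "l * (inner a q) < l * b" using q \<open>0 < l\<close> by simp
      moreover have "(1 - l) * (inner a z) \<le> (1 - l) * b" using z \<open>l \<le> 1\<close> by (intro mult_left_mono) auto
      ultimately have "inner a x < b" unfolding assms(6) by (simp add: inner_add_right algebra_simps)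
      moreover have "open {y. inner a y < b}" by (rule open_halfspace_lt)
      ultimately have "\<forall>\<^sub>F y in nhds x. inner a y < b" using eventually_nhds_in_open[of "{y. inner a y < b}" x] by simp
      then show ?thesis by eventually_elim (auto simp: h)
    qed
  qed
  then have "\<forall>\<^sub>F y in nhds x. \<forall>h\<in>F. q + t *\<^sub>R (y - q) \<in> h \<longrightarrow> y \<in> h"
    using F(1) by (simp add: eventually_ball_finite)
  then show ?thesis by eventually_elim (auto simp: F(2))
qed

text \<open>A homothety with centre \<open>q\<close> and small ratio maps a neighbourhood of \<open>x\<close> into the elements of
  \<open>\<S>\<close> that contain \<open>q\<close>; by the preceding lemma its inverse does not leave these elements.\<close>

lemma triangulation_star:
  fixes \<T> :: "'a::euclidean_space set set"
  assumes tri: "triangulation \<T>" and S: "\<S> \<subseteq> \<T>" and q: "q \<in> interior (\<Union>\<S>)"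
    and T: "T \<in> \<T>" "q \<in> T" "z \<in> T" and l: "0 < l" "l \<le> 1" and x: "x = l *\<^sub>R q + (1 - l) *\<^sub>R z"
  shows "x \<in> interior (\<Union>\<S>)"
proof (cases "x = q")
  case True then show ?thesis using q by simp
next
  case False
  then have ne: "l < 1" "q \<noteq> z" using l x by (cases "l = 1", auto simp flip: scaleR_add_left)
  have fin: "finite \<S>" using tri S finite_subset by (auto simp: triangulation_def)
  have pc: "polytope T'" "closed T'" "convex T'" if "T' \<in> \<T>" for T'
    using tri that simplex_compact_convex compact_imp_closed unfolding triangulation_def by blast+
  \<comment> \<open>A neighbourhood of \<open>q\<close> inside the union that avoids every element
    of \<open>\<S>\<close> not containing \<open>q\<close>; it is open because \<open>\<S>\<close>
    is finite.\<close>
  define O' where "O' = interior (\<Union>\<S>) \<inter> (\<Inter>T'\<in>{T'\<in>\<S>. q \<notin> T'}. - T')"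
  have O: "open O'" "q \<in> O'" unfolding O'_def
    using fin pc S q by (auto intro!: open_Int open_INT open_Compl)
  have "((\<lambda>t. q + t *\<^sub>R (x - q)) \<longlongrightarrow> q + 0 *\<^sub>R (x - q)) (at_right 0)" by (intro tendsto_intros)
  then have "\<forall>\<^sub>F t in at_right 0. q + t *\<^sub>R (x - q) \<in> O'"
    using O by (intro topological_tendstoD[where l = q]) simp_all
  moreover have "\<forall>\<^sub>F t in at_right 0. t \<in> {0<..<1::real}" by (rule eventually_at_right_real) simp
  ultimately have "\<forall>\<^sub>F t in at_right 0. q + t *\<^sub>R (x - q) \<in> O' \<and> t \<in> {0<..<1::real}" by (rule eventually_conj)
  then obtain t :: real where t: "0 < t" "t < 1" "q + t *\<^sub>R (x - q) \<in> O'"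
    using eventually_happens[of _ "at_right (0::real)"] by auto
  let ?g = "\<lambda>y. q + t *\<^sub>R (y - q)"
  have cont: "(?g \<longlongrightarrow> ?g x) (nhds x)" by (intro tendsto_intros filterlim_ident)
  have step: "\<forall>\<^sub>F y in nhds x. ?g y \<in> T' \<longrightarrow> y \<in> T'" if T': "T' \<in> \<S>" "q \<in> T'" for T'
  proof (cases "?g x \<in> T'")
    \<comment> \<open>The image of \<open>x\<close> lies strictly between \<open>q\<close> and
      \<open>z\<close>. Since it belongs to the face \<open>T \<inter> T'\<close> of
      \<open>T\<close>, the endpoint \<open>z\<close> does too, so \<open>x\<close> is a combination
      of \<open>q\<close> and a point of \<open>T'\<close>, as the scaling lemma requires.\<close>
    case True
    have face: "(T \<inter> T') face_of T" using tri T T' S by (auto simp: triangulation_def)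
    have gx: "?g x = (1 - t * (1 - l)) *\<^sub>R q + (t * (1 - l)) *\<^sub>R z"
      unfolding x by (simp add: algebra_simps)
    have u: "0 < t * (1 - l)" "t * (1 - l) < 1" using t l ne mult_less_cancel_right2[of t "1-l"]
      by (auto intro: order.strict_trans1[of _ "1 - l"] simp: mult_le_cancel_right2 mult_le_one)
    then have gs: "?g x \<in> open_segment q z"
      unfolding in_segment gx using ne by blast
    have "?g x \<in> T" unfolding gx using convexD[OF pc(3)[OF T(1)] T(2,3)] u by simp
    then have "z \<in> T'" using face gs T(2,3) True unfolding face_of_def by blast
    then show ?thesis using polytope_eventually_scaling[OF pc(1) T'(2) _ l x t(1)] T' S by blast
  next
    case False
    have "open (- T')" using pc(2) T' S by (intro open_Compl) blast
    then have "\<forall>\<^sub>F y in nhds x. ?g y \<in> - T'" using cont False topological_tendstoD by (metis ComplI)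
    then show ?thesis by eventually_elim auto
  qed
  have "\<forall>\<^sub>F y in nhds x. ?g y \<in> O'" using cont O(1) t(3) by (rule topological_tendstoD)
  moreover have "\<forall>\<^sub>F y in nhds x. \<forall>T'\<in>{T'\<in>\<S>. q \<in> T'}. ?g y \<in> T' \<longrightarrow> y \<in> T'"
    using fin step by (intro eventually_ball_finite) auto
  ultimately have "\<forall>\<^sub>F y in nhds x. y \<in> \<Union>\<S>"
  proof eventually_elim
    case (elim y)
    then have "?g y \<in> \<Union>\<S>" using interior_subset[of "\<Union>\<S>"] by (auto simp: O'_def)
    then obtain T' where T': "T' \<in> \<S>" "?g y \<in> T'" by (rule UnionE)
    moreover have "q \<in> T'" using elim(1) T' by (auto simp: O'_def)
    ultimately have "y \<in> T'" using elim(2) by simp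
    then show ?case using T'(1) by (rule UnionI[rotated])
  qed
  then show ?thesis by (auto simp: eventually_nhds interior_def)
qed

section \<open>Barycentric evaluation and zero sets of fine functions\<close>

lemma convex_hull_split:
  fixes S :: "'a::real_vector set"
  assumes "finite C" "\<And>p. p \<in> C \<Longrightarrow> 0 \<le> u p" "sum u C = 1" "q \<in> C" "convex S" "C \<subseteq> S"
  shows "\<exists>z\<in>S. (\<Sum>p\<in>C. u p *\<^sub>R p) = u q *\<^sub>R q + (1 - u q) *\<^sub>R z"
proof -
  have s: "(\<Sum>p\<in>C. u p *\<^sub>R p) = u q *\<^sub>R q + (\<Sum>p\<in>C-{q}. u p *\<^sub>R p)" "sum u (C - {q}) = 1 - u q"
    using sum.remove[OF assms(1,4), of "\<lambda>p. u p *\<^sub>R p"] sum.remove[OF assms(1,4), of u] assms(3) by simp_all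
  show ?thesis
  proof (cases "u q = 1")
    case True
    then have "sum u (C - {q}) = 0" using s by simp
    then have "\<And>p. p\<in>C-{q} \<Longrightarrow> u p = 0" using assms by (subst (asm) sum_nonneg_eq_0_iff) auto
    then have "(\<Sum>p\<in>C-{q}. u p *\<^sub>R p) = 0" by (intro sum.neutral) auto
    then show ?thesis using s True assms by (intro bexI[of _ q]) auto
  next
    case False
    have "0 \<le> sum u (C - {q})" using assms by (intro sum_nonneg) auto
    then have pos: "0 < 1 - u q" using s False by simp
    define z where "z = (\<Sum>p\<in>C-{q}. (u p / (1 - u q)) *\<^sub>R p)"
    have "z \<in> S" unfolding z_def
      using assms pos s(2) by (intro convex_sum) (auto simp: sum_divide_distrib[symmetric])
    moreover have "(1 - u q) *\<^sub>R z = (\<Sum>p\<in>C-{q}. u p *\<^sub>R p)"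
      using pos by (simp add: z_def scaleR_sum_right)
    ultimately show ?thesis using s by (intro bexI[of _ z]) auto
  qed
qed

text \<open>The weights are fixed before \<open>v\<close>: one and the same convex combination of
  vertex values evaluates every fine function at \<open>x\<close>. This uniformity later permits
  summing over all cut-offs under a single choice of weights.\<close>

lemma P1_barycentric:
  fixes \<T> :: "(real ^ 'd) set set"
  assumes tri: "triangulation \<T>" and T: "T \<in> \<T>" "x \<in> T"
  obtains C u where "finite C" "C \<subseteq> vertices \<T> \<inter> T" "\<And>p. p \<in> C \<Longrightarrow> 0 \<le> u p" "sum u C = 1"
    "x = (\<Sum>p\<in>C. u p *\<^sub>R p)" "\<And>v. v \<in> P1 \<T> \<Longrightarrow> v x = (\<Sum>p\<in>C. u p * v p)"
proof -
  obtain n where n: "n simplex T" using tri T by (auto simp: triangulation_def)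
  have "x \<in> convex hull {p. p extreme_point_of T}"
    using Krein_Milman_Minkowski[of T] simplex_compact_convex[OF n] T by auto
  then obtain C u where C: "finite C" "C \<subseteq> {p. p extreme_point_of T}" "\<And>p. p \<in> C \<Longrightarrow> 0 \<le> u p"
      "sum u C = 1" "x = (\<Sum>p\<in>C. u p *\<^sub>R p)"
    unfolding convex_hull_explicit by blast
  then have CT: "C \<subseteq> vertices \<T> \<inter> T" using T by (auto simp: vertices_def extreme_point_of_def)
  have "v x = (\<Sum>p\<in>C. u p * v p)" if v: "v \<in> P1 \<T>" for v
  proof -
    obtain b c where bc: "\<forall>x\<in>T. v x = inner b x + c" using P1_affine[OF v T(1)] by blast
    have "v x = inner b (\<Sum>p\<in>C. u p *\<^sub>R p) + c" using T bc C(5) by simp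
    also have "\<dots> = (\<Sum>p\<in>C. u p * (inner b p + c))"
      using C(4) by (simp add: inner_sum_right distrib_left sum.distrib flip: sum_distrib_right)
    also have "\<dots> = (\<Sum>p\<in>C. u p * v p)" using CT bc by (intro sum.cong refl) (metis Int_iff subset_iff)
    finally show ?thesis .
  qed
  then show ?thesis using that C CT by blast
qed

text \<open>If a vertex \<open>q\<close> in the interior had positive weight at \<open>x\<close>,
  then \<open>x\<close> would lie on a segment from \<open>q\<close> within an element, short of its
  far end, and \<open>triangulation_star\<close> would put \<open>x\<close> into the interior. Hence
  only vertices with value zero contribute at \<open>x\<close>.\<close>

lemma P1_vanishes_outside:
  fixes \<T> :: "(real ^ 'd) set set"
  assumes tri: "triangulation \<T>" and S: "\<S> \<subseteq> \<T>" and v: "v \<in> P1 \<T>"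
    and zero: "\<And>q. q \<in> vertices \<T> \<Longrightarrow> q \<notin> interior (\<Union>\<S>) \<Longrightarrow> v q = 0"
    and x: "x \<notin> interior (\<Union>\<S>)"
  shows "v x = 0"
proof (cases "x \<in> \<Union>\<T>")
  case True
  then obtain T where T: "T \<in> \<T>" "x \<in> T" by auto
  obtain C u where C: "finite C" "C \<subseteq> vertices \<T> \<inter> T" "\<And>p. p \<in> C \<Longrightarrow> 0 \<le> u p" "sum u C = 1"
    "x = (\<Sum>p\<in>C. u p *\<^sub>R p)" and vx: "\<And>v. v \<in> P1 \<T> \<Longrightarrow> v x = (\<Sum>p\<in>C. u p * v p)"
    using P1_barycentric[OF tri T] by blast
  have conv: "convex T" using tri T simplex_compact_convex unfolding triangulation_def by blast
  have "u q * v q = 0" if q: "q \<in> C" for q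
  proof (cases "u q = 0 \<or> v q = 0")
    case False
    then have qi: "q \<in> interior (\<Union>\<S>)" "q \<in> T" using zero q C(2) by blast+
    have uq: "0 < u q" using C(3)[OF q] False by simp
    have "u q \<le> 1" using C q member_le_sum[of q C u] by auto
    moreover obtain z where "z \<in> T" "x = u q *\<^sub>R q + (1 - u q) *\<^sub>R z"
      using convex_hull_split[OF C(1,3,4) q conv] C by auto
    ultimately have "x \<in> interior (\<Union>\<S>)"
      using triangulation_star[OF tri S qi(1) T(1) qi(2) _ uq] by blast
    then show ?thesis using x by simp
  qed auto
  then show ?thesis using vx[OF v] by simp
next
  case False then show ?thesis using v by (auto simp: P1_def)
qed

section \<open>Spectra and subspace solves\<close>

text \<open>Splitting a complex eigenvector into real and imaginary parts \<open>x\<close> and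
  \<open>y\<close>, selfadjointness in the inner product \<open>e\<close> gives
  \<open>Im k * (e x x + e y y) = 0\<close>, so the eigenvalue is real; then \<open>x\<close> or
  \<open>y\<close> is a real eigenvector, and its Rayleigh quotient lies between \<open>c1\<close>
  and \<open>c2\<close>.\<close>

lemma spectrum_real_selfadjoint:
  fixes T :: "real mat" and e :: "real Matrix.vec \<Rightarrow> real Matrix.vec \<Rightarrow> real"
  assumes T: "T \<in> carrier_mat n n"
    and sym: "\<And>x y. x \<in> carrier_vec n \<Longrightarrow> y \<in> carrier_vec n \<Longrightarrow> e x y = e y x"
    and add: "\<And>x y z. x \<in> carrier_vec n \<Longrightarrow> y \<in> carrier_vec n \<Longrightarrow> z \<in> carrier_vec n \<Longrightarrow> e (x + y) z = e x z + e y z"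
    and smult: "\<And>c x y. x \<in> carrier_vec n \<Longrightarrow> y \<in> carrier_vec n \<Longrightarrow> e (c \<cdot>\<^sub>v x) y = c * e x y"
    and pos: "\<And>x. x \<in> carrier_vec n \<Longrightarrow> x \<noteq> 0\<^sub>v n \<Longrightarrow> 0 < e x x"
    and selfadj: "\<And>x y. x \<in> carrier_vec n \<Longrightarrow> y \<in> carrier_vec n \<Longrightarrow> e (T *\<^sub>v x) y = e x (T *\<^sub>v y)"
    and lower: "\<And>x. x \<in> carrier_vec n \<Longrightarrow> c1 * e x x \<le> e (T *\<^sub>v x) x"
    and upper: "\<And>x. x \<in> carrier_vec n \<Longrightarrow> e (T *\<^sub>v x) x \<le> c2 * e x x"
  shows "spectrum (map_mat complex_of_real T) \<subseteq> complex_of_real ` {c1..c2} \<and> spectrum T \<subseteq> {c1..c2}"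
proof
  have bounds: "c1 \<le> r \<and> r \<le> c2"
    if x: "x \<in> carrier_vec n" "x \<noteq> 0\<^sub>v n" and eq: "e (T *\<^sub>v x) x = r * e x x" for x r
    using lower[OF x(1)] upper[OF x(1)] pos[OF x] unfolding eq by simp
  have dim: "dim_row T = n" "dim_col T = n" using T by auto
  show "spectrum (map_mat complex_of_real T) \<subseteq> complex_of_real ` {c1..c2}"
  proof
    fix k assume "k \<in> spectrum (map_mat complex_of_real T)"
    then obtain z where z: "z \<in> carrier_vec n" "z \<noteq> 0\<^sub>v n" "map_mat complex_of_real T *\<^sub>v z = k \<cdot>\<^sub>v z"
      using T by (auto simp: spectrum_def eigenvalue_def eigenvector_def)
    define x where "x = map_vec Re z"
    define y where "y = map_vec Im z"
    have xy: "x \<in> carrier_vec n" "y \<in> carrier_vec n" using z by (auto simp: x_def y_def)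
    have comp: "(\<Sum>j = 0..<n. complex_of_real (T $$ (i, j)) * z $ j) = k * z $ i" if "i < n" for i
      using arg_cong[OF z(3), of "\<lambda>v. v $ i"] that z(1) dim
      by (simp add: scalar_prod_def row_def)
    have Tx: "T *\<^sub>v x = Re k \<cdot>\<^sub>v x + (- Im k) \<cdot>\<^sub>v y"
    proof (rule eq_vecI)
      fix i assume "i < dim_vec (Re k \<cdot>\<^sub>v x + (- Im k) \<cdot>\<^sub>v y)"
      then have i: "i < n" using xy by auto
      from arg_cong[OF comp[OF i], of Re] i z(1) dim
      show "(T *\<^sub>v x) $ i = (Re k \<cdot>\<^sub>v x + (- Im k) \<cdot>\<^sub>v y) $ i"
        by (simp add: scalar_prod_def row_def x_def y_def)
    qed (use xy dim in auto)
    have Ty: "T *\<^sub>v y = Im k \<cdot>\<^sub>v x + Re k \<cdot>\<^sub>v y"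
    proof (rule eq_vecI)
      fix i assume "i < dim_vec (Im k \<cdot>\<^sub>v x + Re k \<cdot>\<^sub>v y)"
      then have i: "i < n" using xy by auto
      from arg_cong[OF comp[OF i], of Im] i z(1) dim
      show "(T *\<^sub>v y) $ i = (Im k \<cdot>\<^sub>v x + Re k \<cdot>\<^sub>v y) $ i"
        by (simp add: scalar_prod_def row_def x_def y_def)
    qed (use xy dim in auto)
    have e1: "e (T *\<^sub>v x) w = Re k * e x w - Im k * e y w" "e (T *\<^sub>v y) w = Im k * e x w + Re k * e y w"
      if "w \<in> carrier_vec n" for w
      unfolding Tx Ty using xy that by (simp_all add: add smult)
    have nz: "x \<noteq> 0\<^sub>v n \<or> y \<noteq> 0\<^sub>v n"
    proof (rule ccontr)
      assume *: "\<not> ?thesis"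
      have "z $ i = 0" if "i < n" for i
      proof -
        have "x $ i = 0" "y $ i = 0" using * that by auto
        then show ?thesis using that z(1) by (simp add: x_def y_def complex_eq_iff)
      qed
      then have "z = 0\<^sub>v n" using z(1) by (intro eq_vecI) auto
      then show False using z(2) by simp
    qed
    have nonneg: "0 \<le> e w w" if "w \<in> carrier_vec n" for w
    proof (cases "w = 0\<^sub>v n")
      case True
      have "e (0 \<cdot>\<^sub>v w) w = 0" using smult[OF that that, of 0] by simp
      moreover have "0 \<cdot>\<^sub>v w = w" using True by auto
      ultimately show ?thesis by simp
    qed (use pos[OF that] in auto)
    have "e (T *\<^sub>v x) y = e x (T *\<^sub>v y)" using selfadj xy by blast
    also have "\<dots> = e (T *\<^sub>v y) x" using sym xy T by auto
    finally have "Im k * (e x x + e y y) = 0" using e1 xy sym[OF xy] by (simp add: algebra_simps)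
    moreover have "0 < e x x + e y y"
      using nz pos[OF xy(1)] pos[OF xy(2)] nonneg[OF xy(1)] nonneg[OF xy(2)] by force
    ultimately have Im: "Im k = 0" by auto
    have "c1 \<le> Re k \<and> Re k \<le> c2"
      using nz
    proof
      assume "x \<noteq> 0\<^sub>v n" then show ?thesis using bounds[OF xy(1)] e1(1)[OF xy(1)] Im by simp
    next
      assume "y \<noteq> 0\<^sub>v n" then show ?thesis using bounds[OF xy(2)] e1(2)[OF xy(2)] Im by simp
    qed
    moreover have "k = complex_of_real (Re k)" using Im by (simp add: complex_eq_iff)
    ultimately show "k \<in> complex_of_real ` {c1..c2}" by (metis atLeastAtMost_iff imageI)
  qed
  show "spectrum T \<subseteq> {c1..c2}"
  proof
    fix r assume "r \<in> spectrum T"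
    then obtain x where x: "x \<in> carrier_vec n" "x \<noteq> 0\<^sub>v n" "T *\<^sub>v x = r \<cdot>\<^sub>v x"
      using T by (auto simp: spectrum_def eigenvalue_def eigenvector_def)
    then show "r \<in> {c1..c2}" using bounds[OF x(1,2), of r] smult by auto
  qed
qed

text \<open>\<open>Max\<close> and \<open>Min\<close> say nothing about an empty set, so a real
  eigenvalue must be produced: a complex one exists, it is real by \<open>spec\<close>, and it is
  therefore a root of the real characteristic polynomial. The \<open>max 1\<close> covers the empty
  matrix, whose condition number is 1 by convention.\<close>

lemma cond_le:
  fixes T :: "real mat"
  assumes T: "T \<in> carrier_mat n n" and c1: "0 < c1"
    and spec: "spectrum (map_mat complex_of_real T) \<subseteq> complex_of_real ` {c1..c2}"
    and specr: "spectrum T \<subseteq> {c1..c2}"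
  shows "cond T \<le> max 1 (c2 / c1)"
proof (cases "n = 0")
  case True
  then show ?thesis using T by (simp add: cond_def)
next
  case False
  have Tc: "map_mat complex_of_real T \<in> carrier_mat n n" using T by simp
  obtain k where "k \<in> spectrum (map_mat complex_of_real T)"
    using spectrum_non_empty[OF Tc] False by auto
  moreover then obtain r where "k = complex_of_real r" using spec by auto
  ultimately have "poly (map_poly complex_of_real (char_poly T)) (complex_of_real r) = 0"
    using spectrum_root_char_poly[OF Tc] by (simp add: of_real_hom.char_poly_hom[OF T])
  then have "poly (char_poly T) r = 0" by (simp add: of_real_hom.poly_map_poly)
  then have ne: "spectrum T \<noteq> {}" using spectrum_root_char_poly[OF T] by auto
  have fin: "finite (spectrum T)" by (rule card_finite_spectrum[OF T])
  have "Max (spectrum T) \<in> {c1..c2}" "Min (spectrum T) \<in> {c1..c2}"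
    using Max_in[OF fin ne] Min_in[OF fin ne] specr by auto
  then have "Max (spectrum T) / Min (spectrum T) \<le> c2 / c1"
    using c1 by (intro frac_le) auto
  then show ?thesis using T False by (simp add: cond_def max_def)
qed

section \<open>Subspace solves as orthogonal projections\<close>

lemma mat_inverse_pos_def:
  fixes A :: "real mat"
  assumes A: "A \<in> carrier_mat n n"
    and pos: "\<And>x. x \<in> carrier_vec n \<Longrightarrow> x \<noteq> 0\<^sub>v n \<Longrightarrow> 0 < x \<bullet> (A *\<^sub>v x)"
  shows "the (mat_inverse A) \<in> carrier_mat n n" "A * the (mat_inverse A) = 1\<^sub>m n"
proof -
  have "det A \<noteq> 0"
  proof
    assume "det A = 0"
    then obtain v where v: "v \<in> carrier_vec n" "v \<noteq> 0\<^sub>v n" "A *\<^sub>v v = 0\<^sub>v n"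
      using det_0_iff_vec_prod_zero_field[OF A] by auto
    then show False using pos[OF v(1,2)] by simp
  qed
  then obtain B where "mat_inverse A = Some B"
    using mat_inverse(1)[OF A, where ?b = "0::nat"] det_non_zero_imp_unit[OF A, where ?b = "0::nat"] by (cases "mat_inverse A") auto
  then show "the (mat_inverse A) \<in> carrier_mat n n" "A * the (mat_inverse A) = 1\<^sub>m n"
    using mat_inverse(2)[OF A] by auto
qed

lemma scalar_prod_transpose:
  fixes R :: "real mat"
  assumes "R \<in> carrier_mat n r" "v \<in> carrier_vec n" "y \<in> carrier_vec r"
  shows "y \<bullet> (transpose_mat R *\<^sub>v v) = (R *\<^sub>v y) \<bullet> v"
  using assms by (metis comm_scalar_prod mult_mat_vec_carrier transpose_carrier_mat transpose_vec_mult_scalar)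

text \<open>The Galerkin matrix \<open>L\<close> inherits definiteness from \<open>G\<close> because
  the columns of \<open>R\<close> are independent (\<open>inj\<close>), so its inverse is genuine.
  The equations for \<open>y\<close> say that the solve composed with \<open>G\<close> is the
  \<open>G\<close>-orthogonal projection onto the range of \<open>R\<close>.\<close>

lemma subspace_solve:
  fixes M A R :: "real mat" and dt :: real
  defines "G \<equiv> M + dt \<cdot>\<^sub>m A"
  assumes M: "M \<in> carrier_mat n n" and A: "A \<in> carrier_mat n n" and R: "R \<in> carrier_mat n r"
    and pos: "\<And>x. x \<in> carrier_vec n \<Longrightarrow> x \<noteq> 0\<^sub>v n \<Longrightarrow> 0 < x \<bullet> (G *\<^sub>v x)"
    and inj: "\<And>y. y \<in> carrier_vec r \<Longrightarrow> R *\<^sub>v y = 0\<^sub>v n \<Longrightarrow> y = 0\<^sub>v r"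
  shows "subspace_solve dt M A R \<in> carrier_mat n n"
    and "x \<in> carrier_vec n \<Longrightarrow> \<exists>y\<in>carrier_vec r. subspace_solve dt M A R *\<^sub>v (G *\<^sub>v x) = R *\<^sub>v y \<and>
      (\<forall>y'\<in>carrier_vec r. (R *\<^sub>v y') \<bullet> (G *\<^sub>v (R *\<^sub>v y)) = (R *\<^sub>v y') \<bullet> (G *\<^sub>v x))"
proof -
  let ?Rt = "transpose_mat R"
  have Rt: "?Rt \<in> carrier_mat r n" using R by simp
  have G: "G \<in> carrier_mat n n" using M A by (simp add: G_def)
  define L where "L = ?Rt * G * R"
  have L: "L \<in> carrier_mat r r" using Rt G R by (simp add: L_def)
  have Leq: "?Rt * M * R + dt \<cdot>\<^sub>m (?Rt * A * R) = L"
    unfolding L_def G_def using M A R Rt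
    by (simp add: mult_add_distrib_mat[of _ r n] add_mult_distrib_mat[of _ r n] mult_smult_distrib[of _ r n _ n]
        mult_smult_assoc_mat[of _ r n])
  have Lv: "L *\<^sub>v y = ?Rt *\<^sub>v (G *\<^sub>v (R *\<^sub>v y))" if "y \<in> carrier_vec r" for y
    using that G R Rt by (simp add: L_def assoc_mult_mat_vec[of _ r n] assoc_mult_mat_vec[of _ r n _ r])
  have "0 < y \<bullet> (L *\<^sub>v y)" if y: "y \<in> carrier_vec r" "y \<noteq> 0\<^sub>v r" for y
  proof -
    have "y \<bullet> (L *\<^sub>v y) = (R *\<^sub>v y) \<bullet> (G *\<^sub>v (R *\<^sub>v y))"
      using y G R Lv by (simp add: scalar_prod_transpose[OF R])
    then show ?thesis using pos[of "R *\<^sub>v y"] inj[OF y(1)] y R by auto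
  qed
  note inv = mat_inverse_pos_def[OF L this]
  define J where "J = the (mat_inverse L)"
  have J: "J \<in> carrier_mat r r" "L * J = 1\<^sub>m r" using inv by (auto simp: J_def)
  have B: "subspace_solve dt M A R = R * J * ?Rt"
    by (simp add: subspace_solve_def Let_def Leq J_def)
  show "subspace_solve dt M A R \<in> carrier_mat n n" unfolding B using R J Rt by simp
  assume x: "x \<in> carrier_vec n"
  define y where "y = J *\<^sub>v (?Rt *\<^sub>v (G *\<^sub>v x))"
  have y: "y \<in> carrier_vec r" using J Rt G x by (simp add: y_def)
  have "subspace_solve dt M A R *\<^sub>v (G *\<^sub>v x) = R *\<^sub>v y"
    unfolding B y_def using R J Rt G x by (simp add: assoc_mult_mat_vec[of _ n r _ n] assoc_mult_mat_vec[of _ n r _ r])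
  moreover have "(R *\<^sub>v y') \<bullet> (G *\<^sub>v (R *\<^sub>v y)) = (R *\<^sub>v y') \<bullet> (G *\<^sub>v x)" if y': "y' \<in> carrier_vec r" for y'
  proof -
    have "L *\<^sub>v y = (L * J) *\<^sub>v (?Rt *\<^sub>v (G *\<^sub>v x))"
      unfolding y_def using L J(1) Rt G x by (simp add: assoc_mult_mat_vec[of _ r r _ r])
    also have "\<dots> = ?Rt *\<^sub>v (G *\<^sub>v x)" unfolding J(2) using Rt G x by simp
    finally have "y' \<bullet> (?Rt *\<^sub>v (G *\<^sub>v (R *\<^sub>v y))) = y' \<bullet> (?Rt *\<^sub>v (G *\<^sub>v x))" using Lv y by simp
    then show ?thesis using y' y G R x by (simp add: scalar_prod_transpose[OF R])
  qed
  ultimately show "\<exists>y\<in>carrier_vec r. subspace_solve dt M A R *\<^sub>v (G *\<^sub>v x) = R *\<^sub>v y \<and>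
      (\<forall>y'\<in>carrier_vec r. (R *\<^sub>v y') \<bullet> (G *\<^sub>v (R *\<^sub>v y)) = (R *\<^sub>v y') \<bullet> (G *\<^sub>v x))"
    using y by blast
qed

section \<open>Energy forms on the fine space\<close>

lemma grad_eq:
  fixes f :: "real ^ 'd \<Rightarrow> real"
  assumes "GDERIV f x :> D" shows "grad f x = D"
proof -
  have "GDERIV f x :> grad f x" unfolding grad_def using assms by (rule someI)
  then have "(\<lambda>h. inner h (grad f x)) = (\<lambda>h. inner h D)"
    using assms unfolding gderiv_def by (rule has_derivative_unique)
  then show ?thesis by (metis inner_commute vector_eq_rdot)
qed

lemma GDERIV_affine:
  assumes "open S" "x \<in> S" "\<And>y. y \<in> S \<Longrightarrow> f y = inner b y + c"
  shows "GDERIV f x :> b"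
proof -
  have "((\<lambda>y. inner b y + c) has_derivative (\<lambda>h. inner h b)) (at x)"
    by (auto intro!: derivative_eq_intros simp: inner_commute)
  then have "(f has_derivative (\<lambda>h. inner h b)) (at x)"
    by (rule has_derivative_transform_within_open[OF _ assms(1,2)]) (simp add: assms(3))
  then show ?thesis by (simp add: gderiv_def)
qed

lemma sum_fun_apply: "(\<Sum>i\<in>I. f i) x = (\<Sum>i\<in>I. f i (x::'a) :: 'b::comm_monoid_add)"
  by (induction I rule: infinite_finite_induct) auto

lemma P1_add: "v \<in> P1 \<T> \<Longrightarrow> w \<in> P1 \<T> \<Longrightarrow> v + w \<in> P1 (\<T> :: (real ^ 'd) set set)"
proof -
  assume v: "v \<in> P1 \<T>" and w: "w \<in> P1 \<T>"
  have "\<exists>b c. \<forall>x\<in>T. (v + w) x = inner b x + c" if T: "T \<in> \<T>" for T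
  proof -
    obtain b c b' c' where "\<forall>x\<in>T. v x = inner b x + c" "\<forall>x\<in>T. w x = inner b' x + c'"
      using P1_affine[OF v T] P1_affine[OF w T] by blast
    then show ?thesis by (intro exI[of _ "b + b'"] exI[of _ "c + c'"]) (auto simp: inner_add_left)
  qed
  moreover have "continuous_on (\<Union>\<T>) (\<lambda>x. v x + w x)"
    using v w by (intro continuous_on_add) (auto simp: P1_def)
  ultimately show ?thesis using v w by (auto simp: P1_def plus_fun_def)
qed

lemma P1_scale: "v \<in> P1 \<T> \<Longrightarrow> fscale c v \<in> P1 (\<T> :: (real ^ 'd) set set)"
proof -
  assume v: "v \<in> P1 \<T>"
  have "\<exists>b c'. \<forall>x\<in>T. c * v x = inner b x + c'" if T: "T \<in> \<T>" for T
  proof -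
    obtain b c' where "\<forall>x\<in>T. v x = inner b x + c'" using P1_affine[OF v T] by blast
    then show ?thesis by (intro exI[of _ "c *\<^sub>R b"] exI[of _ "c * c'"]) (auto simp: algebra_simps)
  qed
  moreover have "continuous_on (\<Union>\<T>) (\<lambda>x. c * v x)"
    using v by (intro continuous_on_mult_left) (auto simp: P1_def)
  ultimately show ?thesis using v by (auto simp: P1_def)
qed

lemma P1_zero: "0 \<in> P1 (\<T> :: (real ^ 'd) set set)"
  by (auto simp: P1_def zero_fun_def intro!: continuous_on_const exI[of _ 0])

lemma P2_mult:
  fixes \<T> :: "(real ^ 'd) set set"
  assumes v: "v \<in> P1 \<T>" and w: "w \<in> P1 \<T>"
  shows "(\<lambda>x. v x * w x) \<in> P2 \<T>"
proof -
  have "\<exists>Q b c. \<forall>x\<in>T. v x * w x = inner x (Q *v x) + inner b x + c" if T: "T \<in> \<T>" for T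
  proof -
    obtain b c where 1: "\<forall>x\<in>T. v x = inner b x + c" using P1_affine[OF v T] by blast
    obtain b' c' where 2: "\<forall>x\<in>T. w x = inner b' x + c'" using P1_affine[OF w T] by blast
    \<comment> \<open>A rank-one matrix, chosen so that \<open>inner x (?Q *v x)\<close> is the
      product of the two linear parts.\<close>
    let ?Q = "(\<chi> i j. b $ i * b' $ j) :: real ^ 'd ^ 'd"
    have Q: "?Q *v x = inner b' x *\<^sub>R b" for x
      by (auto simp: matrix_vector_mult_def Finite_Cartesian_Product.vec_eq_iff inner_vec_def sum_distrib_left sum_distrib_right ac_simps)
    have "v x * w x = inner x (?Q *v x) + inner (c *\<^sub>R b' + c' *\<^sub>R b) x + c * c'" if "x \<in> T" for x
      using 1 2 that unfolding Q by (auto simp: algebra_simps inner_commute)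
    then show ?thesis by blast
  qed
  moreover have "continuous_on (\<Union>\<T>) (\<lambda>x. v x * w x)"
    using v w by (intro continuous_on_mult) (auto simp: P1_def)
  ultimately show ?thesis by (auto simp: P2_def)
qed

lemma P1_bounded:
  fixes \<T> :: "(real ^ 'd) set set"
  assumes "triangulation \<T>" "v \<in> P1 \<T>"
  shows "\<exists>B. \<forall>x. \<bar>v x\<bar> \<le> B"
proof -
  have "compact T" if "T \<in> \<T>" for T
    using assms(1) that simplex_compact_convex unfolding triangulation_def by blast
  then have "compact (\<Union>\<T>)" using assms(1) by (intro compact_Union) (auto simp: triangulation_def)
  then have "bounded (v ` \<Union>\<T>)"
    using assms(2) by (intro compact_imp_bounded compact_continuous_image) (auto simp: P1_def)
  then obtain B where B: "\<And>x. x \<in> \<Union>\<T> \<Longrightarrow> \<bar>v x\<bar> \<le> B" unfolding bounded_iff by auto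
  have "\<bar>v x\<bar> \<le> max B 0" for x
  proof (cases "x \<in> \<Union>\<T>")
    case True then show ?thesis using B[of x] by simp
  next
    case False then show ?thesis using assms(2) by (simp add: P1_def)
  qed
  then show ?thesis by blast
qed

section \<open>Gradients, integrability and bilinearity on the given mesh\<close>

context two_level_setting
begin

lemma tri: "triangulation (fine_elems P)"
  and finite_fine: "finite (fine_elems P)"
  using fine_mesh by (auto simp: triangulation_def)

lemma fine_compact: "T \<in> fine_elems P \<Longrightarrow> compact T"
  and fine_convex: "T \<in> fine_elems P \<Longrightarrow> convex T"
  using fine_mesh(2) simplex_compact_convex by blast+

text \<open>With one vertex more than the dimension, affinely independent, a simplex has nonempty
  interior; a convex set with nonempty interior has the same closure as its interior. This is what
  makes the closure of the domain fill the whole mesh.\<close>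

lemma fine_closure_interior: "T \<in> fine_elems P \<Longrightarrow> closure (interior T) = T"
proof -
  assume T: "T \<in> fine_elems P"
  then have "int CARD('d) simplex T" using fine_mesh(2) by simp
  then obtain C where C: "\<not> affine_dependent C" "int (card C) = int CARD('d) + 1" "T = convex hull C"
    unfolding simplex_def by (elim exE conjE)
  then have "card C = Suc DIM(real ^ 'd)" by simp
  then have "interior T \<noteq> {}" using interior_convex_hull_eq_empty C by blast
  then show ?thesis using fine_convex[OF T] fine_compact[OF T]
    by (metis closure_closed compact_imp_closed convex_closure_interior)
qed

lemma interior_fine_subset: "T \<in> fine_elems P \<Longrightarrow> interior T \<subseteq> \<Omega> P"
  unfolding fine_mesh(3) by (intro interior_mono) auto

lemma mesh_closed: "closed (\<Union>(fine_elems P))"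
  using finite_fine fine_compact by (intro closed_Union) (auto intro: compact_imp_closed)

lemma closure_Omega: "closure (\<Omega> P) = \<Union>(fine_elems P)"
proof
  show "closure (\<Omega> P) \<subseteq> \<Union>(fine_elems P)"
    using mesh_closed by (intro closure_minimal) (simp_all add: fine_mesh(3) interior_subset)
  have "T \<subseteq> closure (\<Omega> P)" if "T \<in> fine_elems P" for T
    using closure_mono[OF interior_fine_subset[OF that]] fine_closure_interior[OF that] by simp
  then show "\<Union>(fine_elems P) \<subseteq> closure (\<Omega> P)" by (rule Union_least)
qed

lemma frontier_Omega: "frontier (\<Omega> P) = \<Union>(fine_elems P) - \<Omega> P"
  using domain(1) by (simp add: frontier_def closure_Omega interior_open)

text \<open>The set on which fine functions have a classical gradient. Elsewhere \<open>grad\<close>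
  may be an arbitrary choice, so gradient identities are proved on this set of full measure and then
  used almost everywhere.\<close>

definition U :: "(real ^ 'd) set" where
  "U = (\<Union>T\<in>fine_elems P. interior T)"

lemma U_subset: "U \<subseteq> \<Omega> P"
  using interior_fine_subset by (auto simp: U_def)

lemma Omega_sets [measurable]: "\<Omega> P \<in> sets lebesgue" and Omega_lmeasurable: "\<Omega> P \<in> lmeasurable"
  using domain lmeasurable_open by (auto intro: fmeasurableD)

lemma negligible_frontiers: "negligible (\<Union>T\<in>fine_elems P. frontier T)"
  using finite_fine fine_convex by (intro negligible_Union) (auto intro: negligible_convex_frontier)

lemma Omega_minus_U: "\<Omega> P - U \<subseteq> (\<Union>T\<in>fine_elems P. frontier T)"
proof
  fix x assume x: "x \<in> \<Omega> P - U"
  then have "x \<in> \<Union>(fine_elems P)" using fine_mesh(3) interior_subset[of "\<Union>(fine_elems P)"] by blast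
  then obtain T where "T \<in> fine_elems P" "x \<in> T" by blast
  then show "x \<in> (\<Union>T\<in>fine_elems P. frontier T)"
    using x closure_subset by (auto simp: frontier_def U_def)
qed

lemma AE_Omega_I:
  assumes "negligible Z" "\<And>x. x \<in> \<Omega> P \<Longrightarrow> x \<notin> Z \<Longrightarrow> Q x"
  shows "AE x in lebesgue_on (\<Omega> P). Q x"
proof -
  have "Z \<in> null_sets lebesgue" using assms(1) by (simp add: negligible_iff_null_sets)
  then have "AE x in lebesgue. x \<notin> Z" by (rule AE_not_in)
  then have "AE x in lebesgue. x \<in> \<Omega> P \<longrightarrow> Q x" by eventually_elim (use assms(2) in auto)
  then show ?thesis by (subst AE_restrict_space_iff) (auto simp: Omega_sets)
qed

lemma AE_U: "AE x in lebesgue_on (\<Omega> P). x \<in> U"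
  using negligible_frontiers by (rule AE_Omega_I) (use Omega_minus_U in auto)

lemma affine_interior:
  assumes "v \<in> V_h P" "x \<in> U"
  obtains T b c where "T \<in> fine_elems P" "x \<in> interior T" "\<And>y. y \<in> T \<Longrightarrow> v y = inner b y + c"
    "\<And>y. y \<in> interior T \<Longrightarrow> GDERIV v y :> b"
proof -
  obtain T where T: "T \<in> fine_elems P" "x \<in> interior T" using assms(2) by (auto simp: U_def)
  obtain b c where bc: "\<forall>y\<in>T. v y = inner b y + c"
    using P1_affine T assms(1) unfolding V_h_def by blast
  then have "GDERIV v y :> b" if "y \<in> interior T" for y
    using that interior_subset[of T] by (intro GDERIV_affine[of "interior T" y v b c]) auto
  then show ?thesis using that T bc by blast
qed

lemma grad_V_h: "v \<in> V_h P \<Longrightarrow> x \<in> U \<Longrightarrow> GDERIV v x :> grad v x"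
  by (metis affine_interior grad_eq)

lemma grad_const_interior:
  assumes "v \<in> V_h P" "T \<in> fine_elems P"
  shows "\<exists>b. \<forall>x\<in>interior T. grad v x = b"
proof (cases "interior T = {}")
  case False
  then obtain y where y: "y \<in> interior T" by auto
  obtain b c where bc: "\<forall>y\<in>T. v y = inner b y + c"
    using P1_affine assms unfolding V_h_def by blast
  have "grad v x = b" if "x \<in> interior T" for x
    using that bc interior_subset[of T] by (intro grad_eq GDERIV_affine[of "interior T" x v b c]) auto
  then show ?thesis by blast
qed auto

lemma grad_add: "u \<in> V_h P \<Longrightarrow> v \<in> V_h P \<Longrightarrow> x \<in> U \<Longrightarrow> grad (u + v) x = grad u x + grad v x"
  using grad_V_h[of u x] grad_V_h[of v x] grad_eq[OF GDERIV_add, of u x "grad u x" v "grad v x"]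
  by (simp add: plus_fun_def)

lemma grad_scale: "u \<in> V_h P \<Longrightarrow> x \<in> U \<Longrightarrow> grad (fscale c u) x = c *\<^sub>R grad u x"
  using grad_eq[OF GDERIV_mult[OF GDERIV_const grad_V_h]] by simp

lemma grad_mult: "u \<in> V_h P \<Longrightarrow> v \<in> V_h P \<Longrightarrow> x \<in> U \<Longrightarrow>
    grad (\<lambda>x. u x * v x) x = u x *\<^sub>R grad v x + v x *\<^sub>R grad u x"
  using grad_eq[OF GDERIV_mult[OF grad_V_h grad_V_h]] by simp

lemma grad_zero_open:
  assumes "open S" "x \<in> S" "\<And>y. y \<in> S \<Longrightarrow> v y = 0"
  shows "grad v x = 0"
  by (rule grad_eq, rule GDERIV_affine[OF assms(1,2), of v 0 0]) (simp add: assms(3))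

lemma V_h_measurable: "v \<in> V_h P \<Longrightarrow> v \<in> borel_measurable (lebesgue_on (\<Omega> P))"
proof -
  assume "v \<in> V_h P"
  then have "continuous_on (closure (\<Omega> P)) v" by (simp add: V_h_def P1_def closure_Omega)
  then have "continuous_on (\<Omega> P) v" using closure_subset continuous_on_subset by blast
  then show ?thesis by (rule continuous_imp_measurable_on_sets_lebesgue) (rule Omega_sets)
qed

lemma V_h_bounded: "v \<in> V_h P \<Longrightarrow> \<exists>B. \<forall>x. \<bar>v x\<bar> \<le> B"
  using P1_bounded[OF tri] by (simp add: V_h_def)

lemma grad_bounded: "v \<in> V_h P \<Longrightarrow> \<exists>B. \<forall>x\<in>U. norm (grad v x) \<le> B"
proof -
  assume v: "v \<in> V_h P"
  obtain b where b: "\<And>T x. T \<in> fine_elems P \<Longrightarrow> x \<in> interior T \<Longrightarrow> grad v x = b T"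
    using grad_const_interior[OF v] by metis
  have "norm (grad v x) \<le> (\<Sum>T\<in>fine_elems P. norm (b T))" if x: "x \<in> U" for x
  proof -
    obtain T where T: "T \<in> fine_elems P" "x \<in> interior T" using x by (auto simp: U_def)
    then have "norm (grad v x) = norm (b T)" using b by simp
    also have "\<dots> \<le> (\<Sum>T\<in>fine_elems P. norm (b T))"
      using finite_fine T by (intro member_le_sum) auto
    finally show ?thesis .
  qed
  then show ?thesis by blast
qed

lemma negligible_subset_sets: "S \<subseteq> \<Omega> P - U \<Longrightarrow> S \<in> sets lebesgue"
  by (rule negligible_imp_sets, rule negligible_subset[OF negligible_frontiers])
    (rule subset_trans[OF _ Omega_minus_U])

text \<open>On the open elements the gradient takes finitely many values. On the rest of the domain
  its values are arbitrary, but every subset of a null set is Lebesgue measurable.\<close>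

lemma grad_measurable: "v \<in> V_h P \<Longrightarrow> grad v \<in> borel_measurable (lebesgue_on (\<Omega> P))"
proof -
  assume v: "v \<in> V_h P"
  obtain b where b: "\<And>T x. T \<in> fine_elems P \<Longrightarrow> x \<in> interior T \<Longrightarrow> grad v x = b T"
    using grad_const_interior[OF v] by metis
  show ?thesis
  proof (rule borel_measurableI)
    fix S :: "(real ^ 'd) set" assume "open S"
    have "grad v -` S \<inter> \<Omega> P = (\<Union>T\<in>{T \<in> fine_elems P. b T \<in> S}. interior T) \<union> (grad v -` S \<inter> (\<Omega> P - U))"
      using b U_subset by (auto simp: U_def)
    moreover have "(\<Union>T\<in>{T \<in> fine_elems P. b T \<in> S}. interior T) \<in> sets lebesgue"
      by (intro borel_open[THEN sets_completionI_sets[of _ lborel, simplified]] open_UN) auto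
    moreover have "grad v -` S \<inter> (\<Omega> P - U) \<in> sets lebesgue"
      by (rule negligible_subset_sets) auto
    ultimately have "grad v -` S \<inter> \<Omega> P \<in> sets lebesgue" by auto
    then show "grad v -` S \<inter> space (lebesgue_on (\<Omega> P)) \<in> sets (lebesgue_on (\<Omega> P))"
      by (simp add: sets_restrict_space_iff Omega_sets)
  qed
qed

lemma integrable_bounded_AE:
  fixes f :: "real ^ 'd \<Rightarrow> real"
  assumes "f \<in> borel_measurable (lebesgue_on (\<Omega> P))" "AE x in lebesgue_on (\<Omega> P). \<bar>f x\<bar> \<le> B"
  shows "integrable (lebesgue_on (\<Omega> P)) f"
    and "integrable (lebesgue_on (\<Omega> P)) (\<lambda>x. \<kappa> P x * f x)"
proof -
  interpret finite_measure "lebesgue_on (\<Omega> P)"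
    using Omega_lmeasurable by (rule finite_measure_lebesgue_on)
  show "integrable (lebesgue_on (\<Omega> P)) f"
    using assms by (intro integrable_const_bound[where B = B]) auto
  have "AE x in lebesgue_on (\<Omega> P). \<bar>\<kappa> P x * f x\<bar> \<le> \<kappa>_max P * B"
    using assms(2) coefficient(3)
  proof eventually_elim
    case (elim x)
    have "\<bar>\<kappa> P x * f x\<bar> = \<bar>\<kappa> P x\<bar> * \<bar>f x\<bar>" by (rule abs_mult)
    also have "\<dots> \<le> \<kappa>_max P * B" using elim coefficient(2) by (intro mult_mono) auto
    finally show ?case .
  qed
  then show "integrable (lebesgue_on (\<Omega> P)) (\<lambda>x. \<kappa> P x * f x)"
    using assms(1) coefficient(1) by (intro integrable_const_bound[where B = "\<kappa>_max P * B"]) auto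
qed

lemma integrable_V_h:
  assumes "u \<in> V_h P" "v \<in> V_h P"
  shows integrable_mult: "integrable (lebesgue_on (\<Omega> P)) (\<lambda>x. u x * v x)"
    and "integrable (lebesgue_on (\<Omega> P)) (\<lambda>x. \<kappa> P x * (u x * v x))"
    and integrable_kappa_grad: "integrable (lebesgue_on (\<Omega> P)) (\<lambda>x. \<kappa> P x * inner (grad u x) (grad v x))"
proof -
  obtain A B where AB: "\<And>x. \<bar>u x\<bar> \<le> A" "\<And>x. \<bar>v x\<bar> \<le> B" using V_h_bounded assms by metis
  have "0 \<le> A" using AB(1)[of 0] by simp
  then have "\<bar>u x * v x\<bar> \<le> A * B" for x unfolding abs_mult using AB by (intro mult_mono) auto
  then have "AE x in lebesgue_on (\<Omega> P). \<bar>u x * v x\<bar> \<le> A * B" by simp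
  moreover have "(\<lambda>x. u x * v x) \<in> borel_measurable (lebesgue_on (\<Omega> P))"
    using V_h_measurable[OF assms(1)] V_h_measurable[OF assms(2)] by measurable
  ultimately show "integrable (lebesgue_on (\<Omega> P)) (\<lambda>x. u x * v x)"
     "integrable (lebesgue_on (\<Omega> P)) (\<lambda>x. \<kappa> P x * (u x * v x))"
    using integrable_bounded_AE by blast+
  obtain C D where CD: "\<forall>x\<in>U. norm (grad u x) \<le> C" "\<forall>x\<in>U. norm (grad v x) \<le> D"
    using grad_bounded[OF assms(1)] grad_bounded[OF assms(2)] by blast
  have "AE x in lebesgue_on (\<Omega> P). \<bar>inner (grad u x) (grad v x)\<bar> \<le> C * D"
    using AE_U
  proof eventually_elim
    case (elim x)
    have "\<bar>inner (grad u x) (grad v x)\<bar> \<le> norm (grad u x) * norm (grad v x)" by (rule Cauchy_Schwarz_ineq2)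
    also have "\<dots> \<le> C * D" using CD elim by (intro mult_mono) (auto intro: order_trans[OF norm_ge_zero])
    finally show ?case .
  qed
  moreover have "(\<lambda>x. inner (grad u x) (grad v x)) \<in> borel_measurable (lebesgue_on (\<Omega> P))"
    using grad_measurable[OF assms(1)] grad_measurable[OF assms(2)] by measurable
  ultimately show "integrable (lebesgue_on (\<Omega> P)) (\<lambda>x. \<kappa> P x * inner (grad u x) (grad v x))"
    using integrable_bounded_AE(2) by blast
qed

lemma V_h_add: "u \<in> V_h P \<Longrightarrow> v \<in> V_h P \<Longrightarrow> u + v \<in> V_h P"
  and V_h_scale: "u \<in> V_h P \<Longrightarrow> fscale c u \<in> V_h P"
  and V_h_zero: "0 \<in> V_h P"
  by (auto simp: V_h_def intro: P1_add P1_scale P1_zero)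

lemma a_form_sym: "a_form P u v = a_form P v u"
  by (simp add: a_form_def inner_commute)

lemma L2_form_sym: "L2_form P u v = L2_form P v u"
  by (simp add: L2_form_def mult.commute)

text \<open>Membership in the fine space matters here: \<open>grad\<close> is a choice and is known
  to be additive only at points where both functions are differentiable.\<close>

lemma a_form_add: 
  assumes "u \<in> V_h P" "v \<in> V_h P" "w \<in> V_h P"
  shows "a_form P (u + v) w = a_form P u w + a_form P v w"
proof -
  have "a_form P (u + v) w = (LINT x|lebesgue_on (\<Omega> P). \<kappa> P x * inner (grad u x) (grad w x) + \<kappa> P x * inner (grad v x) (grad w x))"
    unfolding a_form_def
  proof (rule integral_cong_AE)
    show "AE x in lebesgue_on (\<Omega> P). \<kappa> P x * inner (grad (u + v) x) (grad w x) =
        \<kappa> P x * inner (grad u x) (grad w x) + \<kappa> P x * inner (grad v x) (grad w x)"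
      using AE_U by eventually_elim (use assms in \<open>simp add: grad_add inner_add_left distrib_left\<close>)
  qed (use assms integrable_kappa_grad V_h_add in \<open>auto intro!: borel_measurable_add borel_measurable_integrable\<close>)
  also have "\<dots> = a_form P u w + a_form P v w"
    unfolding a_form_def using assms integrable_kappa_grad by (intro Bochner_Integration.integral_add) auto
  finally show ?thesis .
qed

lemma a_form_scale:
  assumes "u \<in> V_h P" "w \<in> V_h P"
  shows "a_form P (fscale c u) w = c * a_form P u w"
proof -
  have "a_form P (fscale c u) w = (LINT x|lebesgue_on (\<Omega> P). c * (\<kappa> P x * inner (grad u x) (grad w x)))"
    unfolding a_form_def
  proof (rule integral_cong_AE)
    show "AE x in lebesgue_on (\<Omega> P). \<kappa> P x * inner (grad (fscale c u) x) (grad w x) = c * (\<kappa> P x * inner (grad u x) (grad w x))"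
      using AE_U by eventually_elim (use assms in \<open>simp add: grad_scale\<close>)
  qed (use assms integrable_kappa_grad V_h_scale in \<open>auto intro!: borel_measurable_times borel_measurable_integrable\<close>)
  then show ?thesis by (simp add: a_form_def)
qed

lemma L2_form_add: 
  assumes "u \<in> V_h P" "v \<in> V_h P" "w \<in> V_h P"
  shows "L2_form P (u + v) w = L2_form P u w + L2_form P v w"
  using assms integrable_mult[of u w] integrable_mult[of v w] by (simp add: L2_form_def distrib_right)

lemma L2_form_scale:
  assumes "u \<in> V_h P" "w \<in> V_h P"
  shows "L2_form P (fscale c u) w = c * L2_form P u w"
  by (simp add: L2_form_def mult.assoc)

lemma a_form_nonneg: "0 \<le> a_form P u u"
  unfolding a_form_def
proof (rule integral_nonneg_AE)
  show "AE x in lebesgue_on (\<Omega> P). 0 \<le> \<kappa> P x * inner (grad u x) (grad u x)"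
    using coefficient(3) by eventually_elim (use coefficient(2) in auto)
qed

lemma L2_form_nonneg: "0 \<le> L2_form P u u"
  unfolding L2_form_def by (rule integral_nonneg_AE) auto

end

section \<open>Overlap and cut-off estimates\<close>

text \<open>Shrinking \<open>T\<close> towards a maximum point of \<open>|w|\<close> by the factor 4 gives a subset on which
  \<open>|w|\<close> is at least half its maximum; the constant does not depend on the shape of \<open>T\<close>.\<close>

lemma affine_sup_le_integral:
  fixes w :: "real ^ 'd \<Rightarrow> real"
  assumes T: "compact T" "convex T" and w: "\<forall>y\<in>T. w y = inner b y + c" and x: "x \<in> T"
    and int: "integrable (lebesgue_on (interior T)) (\<lambda>y. (w y)\<^sup>2)"
  shows "measure lebesgue (interior T) * (w x)\<^sup>2
    \<le> 4 ^ (CARD('d) + 1) * (LINT y|lebesgue_on (interior T). (w y)\<^sup>2)"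
proof -
  have "continuous_on T (\<lambda>y. inner b y + c)" by (intro continuous_intros)
  then have "continuous_on T (\<lambda>y. \<bar>w y\<bar>)" using w by (intro continuous_on_rabs) (simp cong: continuous_on_cong)
  then obtain p where p: "p \<in> T" "\<And>y. y \<in> T \<Longrightarrow> \<bar>w y\<bar> \<le> \<bar>w p\<bar>"
    using continuous_attains_sup[OF T(1)] x by blast
  define S where "S = interior T"
  define S' where "S' = (\<lambda>y. (1/4) *\<^sub>R y + (3/4) *\<^sub>R p) ` S"
  have S: "open S" "S \<subseteq> T" by (auto simp: S_def interior_subset)
  have S'S: "S' \<subseteq> S"
  proof
    fix z assume "z \<in> S'"
    then obtain y where y: "y \<in> S" "z = (1/4) *\<^sub>R y + (3/4) *\<^sub>R p" by (auto simp: S'_def)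
    have "p - (1/4) *\<^sub>R (p - y) \<in> interior T"
      using T(2) y(1) p(1) unfolding S_def by (intro mem_interior_convex_shrink) auto
    moreover have "p - (1/4) *\<^sub>R (p - y) = z"
      unfolding y(2) by (simp add: Finite_Cartesian_Product.vec_eq_iff algebra_simps)
    ultimately show "z \<in> S" by (simp add: S_def)
  qed
  have "S' = (\<lambda>y. (3/4) *\<^sub>R p + (1/4) *\<^sub>R y) ` S" by (simp add: S'_def add.commute)
  then have S'o: "open S'" using open_affinity[OF S(1), of "1/4" "(3/4) *\<^sub>R p"] by simp
  have bS: "bounded S" using S(2) T(1) compact_imp_bounded bounded_subset by blast
  then have S'm: "S' \<in> lmeasurable" using S'o S'S bounded_subset lmeasurable_open by blast
  have Sm: "S \<in> sets lebesgue" using S(1) bS lmeasurable_open by (blast intro: fmeasurableD)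
  have mS': "measure lebesgue S' = (1/4) ^ CARD('d) * measure lebesgue S"
    using measure_lebesgue_affine[of "1/4" "(3/4) *\<^sub>R p" S] by (simp add: S'_def)
  have low: "(w p)\<^sup>2 / 4 \<le> (w z)\<^sup>2" if z: "z \<in> S'" for z
  proof -
    obtain y where y: "y \<in> S" "z = (1/4) *\<^sub>R y + (3/4) *\<^sub>R p" using z by (auto simp: S'_def)
    have zT: "z \<in> T" "y \<in> T" using z S'S S y by auto
    have "w z = (1/4) * w y + (3/4) * w p"
      using w zT p(1) y(2) by (simp add: inner_add_right field_simps)
    \<comment> \<open>Three quarters of the maximum, reduced by at most one quarter of it.\<close>
    then have "\<bar>w p\<bar> / 2 \<le> \<bar>w z\<bar>" using p(2)[OF zT(2)] by linarith
    then have "(\<bar>w p\<bar> / 2)\<^sup>2 \<le> \<bar>w z\<bar>\<^sup>2" by (intro power_mono) auto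
    then show ?thesis by (simp add: power_divide)
  qed
  have msub: "measure (lebesgue_on S) S' = measure lebesgue S'" "S' \<in> sets (lebesgue_on S)"
    using S'S S'm Sm by (auto simp: measure_restrict_space sets_restrict_space_iff fmeasurableD)
  have "emeasure (lebesgue_on S) S' < \<infinity>"
    using S'S S'm Sm by (simp add: emeasure_restrict_space fmeasurable_def del: emeasure_completion)
  then have intS': "integrable (lebesgue_on S) (indicator S' :: _ \<Rightarrow> real)"
    using msub(2) by simp
  have "(w p)\<^sup>2 / 4 * measure lebesgue S' = (LINT y|lebesgue_on S. (w p)\<^sup>2 / 4 * indicator S' y)"
    using msub S'S by (simp add: Int_absorb2 space_restrict_space)
  also have "\<dots> \<le> (LINT y|lebesgue_on S. (w y)\<^sup>2)"
  proof (rule integral_mono)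
    show "integrable (lebesgue_on S) (\<lambda>y. (w p)\<^sup>2 / 4 * indicator S' y)"
      using intS' by (rule integrable_mult_right)
    show "integrable (lebesgue_on S) (\<lambda>y. (w y)\<^sup>2)" using int by (simp add: S_def)
    show "(w p)\<^sup>2 / 4 * indicator S' y \<le> (w y)\<^sup>2" for y
      using low[of y] by (cases "y \<in> S'") auto
  qed
  \<comment> \<open>One factor 4 comes from squaring the halved maximum, the power
    \<open>4 ^ CARD('d)\<close> from the volume lost in shrinking.\<close>
  finally have "(w p)\<^sup>2 * measure lebesgue S \<le> 4 * 4 ^ CARD('d) * (LINT y|lebesgue_on S. (w y)\<^sup>2)"
    by (simp add: mS' power_divide field_simps)
  moreover have "(w x)\<^sup>2 * measure lebesgue S \<le> (w p)\<^sup>2 * measure lebesgue S"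
    using p(2)[OF x] by (intro mult_right_mono) (simp_all add: abs_le_square_iff)
  ultimately show ?thesis by (simp add: S_def mult.commute)
qed

text \<open>Jensen's inequality for the square, obtained from nonnegativity of the variance.\<close>

lemma square_convex_sum:
  fixes u a :: "'a \<Rightarrow> real"
  assumes "finite C" "\<And>p. p \<in> C \<Longrightarrow> 0 \<le> u p" "sum u C = 1"
  shows "(\<Sum>p\<in>C. u p * a p)\<^sup>2 \<le> (\<Sum>p\<in>C. u p * (a p)\<^sup>2)"
proof -
  define m where "m = (\<Sum>p\<in>C. u p * a p)"
  have "0 \<le> (\<Sum>p\<in>C. u p * (a p - m)\<^sup>2)" using assms by (intro sum_nonneg) auto
  also have "\<dots> = (\<Sum>p\<in>C. u p * (a p)\<^sup>2 - 2 * m * (u p * a p) + m\<^sup>2 * u p)"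
    by (intro sum.cong) (auto simp: power2_eq_square algebra_simps)
  also have "\<dots> = (\<Sum>p\<in>C. u p * (a p)\<^sup>2) - 2 * m * m + m\<^sup>2 * 1"
    by (simp add: sum.distrib sum_subtractf assms(3) m_def flip: sum_distrib_left)
  finally show ?thesis by (simp add: m_def power2_eq_square)
qed

context two_level_setting
begin

text \<open>The open elements are pairwise disjoint and miss only a null part of the domain, so
  integrals can be estimated element by element.\<close>

lemma integral_split:
  fixes f :: "real ^ 'd \<Rightarrow> real"
  assumes f: "integrable (lebesgue_on (\<Omega> P)) f"
  shows "\<And>T. T \<in> fine_elems P \<Longrightarrow> integrable (lebesgue_on (interior T)) f"
    and "(LINT x|lebesgue_on (\<Omega> P). f x) = (\<Sum>T\<in>fine_elems P. LINT x|lebesgue_on (interior T). f x)"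
proof -
  have meas: "interior T \<in> sets lebesgue" if "T \<in> fine_elems P" for T
    using lmeasurable_interior fine_compact[OF that] compact_imp_bounded by (blast intro: fmeasurableD)
  have fO: "set_integrable lebesgue (\<Omega> P) f"
    using f Omega_sets by (simp add: integrable_restrict_space set_integrable_def)
  have fT: "set_integrable lebesgue (interior T) f" if "T \<in> fine_elems P" for T
    using fO meas[OF that] interior_fine_subset[OF that] by (rule set_integrable_subset)
  show "integrable (lebesgue_on (interior T)) f" if "T \<in> fine_elems P" for T
    using fT[OF that] meas[OF that] by (simp add: integrable_restrict_space set_integrable_def)
  have U: "U \<in> sets lebesgue" unfolding U_def using finite_fine meas by (intro sets.finite_UN) auto
  have fU: "set_integrable lebesgue U f" using fO U U_subset by (rule set_integrable_subset)
  have "\<Omega> P - U \<in> null_sets lebesgue"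
    using negligible_subset[OF negligible_frontiers Omega_minus_U] by (simp add: negligible_iff_null_sets)
  then have "AE x in lebesgue. x \<notin> \<Omega> P - U" by (rule AE_not_in)
  then have "(LINT x:\<Omega> P|lebesgue. f x) = (LINT x:U|lebesgue. f x)"
    unfolding set_lebesgue_integral_def
    using fO fU U_subset by (intro integral_cong_AE) (auto simp: set_integrable_def indicator_def)
  also have "\<dots> = (\<Sum>T\<in>fine_elems P. LINT x:interior T|lebesgue. f x)"
    unfolding U_def using finite_fine fT meas triangulation_interiors_disjoint[OF tri]
    by (intro set_integral_finite_Union) (auto simp: disjoint_family_on_def)
  finally show "(LINT x|lebesgue_on (\<Omega> P). f x) = (\<Sum>T\<in>fine_elems P. LINT x|lebesgue_on (interior T). f x)"
    using meas Omega_sets by (simp add: integral_restrict_space set_lebesgue_integral_def)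
qed

lemma V_h0_V_h: "v \<in> V_h0 P \<Longrightarrow> v \<in> V_h P"
  by (simp add: V_h0_def)

lemma V_h0_zero_outside: "v \<in> V_h0 P \<Longrightarrow> x \<notin> \<Omega> P \<Longrightarrow> v x = 0"
  by (cases "x \<in> \<Union>(fine_elems P)") (auto simp: V_h0_def V_h_def P1_def frontier_Omega)

text \<open>Fine functions are zero off the mesh, and the mesh outside the domain is exactly its
  frontier. In this form the inclusion of the local spaces is just an inclusion of supports.\<close>

lemma V_h0_iff: "v \<in> V_h0 P \<longleftrightarrow> v \<in> V_h P \<and> (\<forall>x. x \<notin> \<Omega> P \<longrightarrow> v x = 0)"
  using V_h0_zero_outside frontier_Omega by (auto simp: V_h0_def)

lemma V_h0_add: "u \<in> V_h0 P \<Longrightarrow> v \<in> V_h0 P \<Longrightarrow> u + v \<in> V_h0 P"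
  and V_h0_scale: "u \<in> V_h0 P \<Longrightarrow> fscale c u \<in> V_h0 P"
  and V_h0_null: "0 \<in> V_h0 P"
  by (auto simp: V_h0_iff V_h_add V_h_scale V_h_zero)

lemma V_h_diff: "u \<in> V_h P \<Longrightarrow> v \<in> V_h P \<Longrightarrow> u - v \<in> V_h P"
  using V_h_add[OF _ V_h_scale[of v "-1"], of u] by (simp add: plus_fun_def fun_diff_def)

lemma V_h0_diff: "u \<in> V_h0 P \<Longrightarrow> v \<in> V_h0 P \<Longrightarrow> u - v \<in> V_h0 P"
  by (simp add: V_h0_iff V_h_diff)

lemma V_h0_lincomb: "(\<And>i. i \<in> I \<Longrightarrow> f i \<in> V_h0 P) \<Longrightarrow> (\<lambda>x. \<Sum>i\<in>I. c i * f i x) \<in> V_h0 P"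
proof (induction I rule: infinite_finite_induct)
  case (insert j I)
  have "fscale (c j) (f j) + (\<lambda>x. \<Sum>i\<in>I. c i * f i x) \<in> V_h0 P"
    using insert by (intro V_h0_add V_h0_scale) auto
  then show ?case using insert by (simp add: plus_fun_def)
qed (use V_h0_null in \<open>simp_all add: zero_fun_def\<close>)

definition patch :: "nat \<Rightarrow> (real ^ 'd) set set" where
  "patch i = (add_layer (fine_elems P) ^^ layers P i) (coarse_elems P i)"

lemma omega_patch: "\<omega> P i = interior (\<Union>(patch i))"
  by (simp add: \<omega>_def patch_def)

lemma patch_subset: "i \<in> {1..N P} \<Longrightarrow> patch i \<subseteq> fine_elems P"
proof -
  assume i: "i \<in> {1..N P}"
  have "(add_layer (fine_elems P) ^^ k) (coarse_elems P i) \<subseteq> fine_elems P" for k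
    using coarse_mesh(3) i by (cases k) (auto simp: add_layer_def)
  then show ?thesis by (simp add: patch_def)
qed

lemma omega_subset: "i \<in> {1..N P} \<Longrightarrow> \<omega> P i \<subseteq> \<Omega> P"
  using patch_subset unfolding omega_patch fine_mesh(3) by (intro interior_mono Union_mono)

lemma frontier_omega: "i \<in> {1..N P} \<Longrightarrow> frontier (\<omega> P i) \<subseteq> (\<Union>T\<in>fine_elems P. frontier T)"
proof -
  assume i: "i \<in> {1..N P}"
  have "frontier (\<omega> P i) \<subseteq> frontier (\<Union>(patch i))"
    unfolding omega_patch by (rule frontier_interior_subset)
  also have "\<dots> \<subseteq> (\<Union>T\<in>patch i. frontier T)"
    using patch_subset[OF i] finite_fine finite_subset by (intro frontier_Union_subset) blast
  also have "\<dots> \<subseteq> (\<Union>T\<in>fine_elems P. frontier T)" using patch_subset[OF i] by blast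
  finally show ?thesis .
qed

text \<open>The boundary of each \<open>\<omega> P i\<close> runs along element boundaries. Hence a
  point of this set outside \<open>\<omega> P i\<close> has a whole neighbourhood outside it, and a
  function vanishing off \<open>\<omega> P i\<close> has zero gradient there.\<close>

definition good :: "(real ^ 'd) set" where
  "good = \<Omega> P - (\<Union>T\<in>fine_elems P. frontier T)"

lemma AE_good: "AE x in lebesgue_on (\<Omega> P). x \<in> good"
  using negligible_frontiers by (rule AE_Omega_I) (simp add: good_def)

lemma grad_zero_off_omega:
  assumes "i \<in> {1..N P}" "x \<in> good" "x \<notin> \<omega> P i" "\<And>y. y \<in> \<Omega> P - \<omega> P i \<Longrightarrow> v y = 0"
  shows "grad v x = 0"
proof (rule grad_zero_open)
  show "open (\<Omega> P - closure (\<omega> P i))" using domain(1) by (intro open_Diff) auto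
  have "x \<notin> closure (\<omega> P i)"
    using frontier_omega[OF assms(1)] assms(2,3) interior_subset by (auto simp: good_def frontier_def)
  then show "x \<in> \<Omega> P - closure (\<omega> P i)" using assms(2) by (simp add: good_def)
  show "v y = 0" if "y \<in> \<Omega> P - closure (\<omega> P i)" for y
    using that closure_subset assms(4) by blast
qed

text \<open>\<open>overlap\<close> is a maximum over infinitely many points; it is a true maximum
  because the cardinalities are at most \<open>N P\<close> and so form a finite set.\<close>

lemma card_overlap: "x \<in> \<Omega> P \<Longrightarrow> card {i \<in> {1..N P}. x \<in> \<omega> P i} \<le> m"
proof -
  assume x: "x \<in> \<Omega> P"
  have "card {i \<in> {1..N P}. x \<in> \<omega> P i} \<le> card {1..N P}" for x
    by (intro card_mono) auto
  then have "card {i \<in> {1..N P}. x \<in> \<omega> P i} \<le> N P" for x by simp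
  then have "(\<lambda>x. card {i \<in> {1..N P}. x \<in> \<omega> P i}) ` \<Omega> P \<subseteq> {..N P}" by blast
  then have "finite ((\<lambda>x. card {i \<in> {1..N P}. x \<in> \<omega> P i}) ` \<Omega> P)" by (rule finite_subset) simp
  then have "card {i \<in> {1..N P}. x \<in> \<omega> P i} \<le> overlap P"
    unfolding overlap_def using x by (intro Max_ge) auto
  then show ?thesis using overlapping(3) by simp
qed

lemma sum_overlap:
  fixes g :: "nat \<Rightarrow> real"
  assumes "x \<in> \<Omega> P" "\<And>i. i \<in> {1..N P} \<Longrightarrow> x \<in> \<omega> P i \<Longrightarrow> g i \<le> B"
    "\<And>i. i \<in> {1..N P} \<Longrightarrow> x \<notin> \<omega> P i \<Longrightarrow> g i \<le> 0" "0 \<le> B"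
  shows "(\<Sum>i\<in>{1..N P}. g i) \<le> real m * B"
proof -
  have "(\<Sum>i\<in>{1..N P}. g i) \<le> (\<Sum>i\<in>{1..N P}. if x \<in> \<omega> P i then B else 0)"
    using assms by (intro sum_mono) auto
  also have "\<dots> = real (card {i \<in> {1..N P}. x \<in> \<omega> P i}) * B"
    by (simp add: sum.inter_filter[symmetric])
  also have "\<dots> \<le> real m * B" using card_overlap[OF assms(1)] assms(4) by (intro mult_right_mono) auto
  finally show ?thesis .
qed

text \<open>The integrand of \<open>at_form\<close>; the number of overlapping subdomains can only
  be counted pointwise, under the integral.\<close>

definition density :: "real \<Rightarrow> (real ^ 'd \<Rightarrow> real) \<Rightarrow> (real ^ 'd \<Rightarrow> real) \<Rightarrow> real ^ 'd \<Rightarrow> real" where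
  "density dt u v x = dt * (\<kappa> P x * inner (grad u x) (grad v x)) + u x * v x"

lemma at_form_density:
  assumes "u \<in> V_h P" "v \<in> V_h P"
  shows "integrable (lebesgue_on (\<Omega> P)) (density dt u v)"
    and "at_form P dt u v = (LINT x|lebesgue_on (\<Omega> P). density dt u v x)"
  using integrable_V_h[OF assms] by (simp_all add: density_def[abs_def] at_form_def a_form_def L2_form_def)

lemma inner_le_half_squares: "inner a b \<le> inner a a / 2 + inner b b / (2::real)"
  for a b :: "'x::real_inner"
  using inner_ge_zero[of "a - b"] by (simp add: inner_diff_left inner_diff_right inner_commute)

text \<open>Young's inequality is applied at each point, and only for those \<open>i\<close> with
  the point in \<open>\<omega> P i\<close>. The energy of \<open>u\<close> is thus counted at most
  \<open>m\<close> times, whereas a global inequality for each \<open>i\<close> would count it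
  \<open>N P\<close> times.\<close>

lemma at_form_overlap:
  assumes dt: "0 < dt" and u: "u \<in> V_h P" and p: "\<And>i. i \<in> {1..N P} \<Longrightarrow> p i \<in> V_sub P i"
  shows "(\<Sum>i\<in>{1..N P}. at_form P dt (p i) u)
    \<le> (\<Sum>i\<in>{1..N P}. at_form P dt (p i) (p i)) / 2 + real m * at_form P dt u u / 2"
proof -
  let ?J = "{1..N P}" and ?M = "lebesgue_on (\<Omega> P)"
  have pV: "p i \<in> V_h P" and p0: "\<And>x. x \<notin> \<omega> P i \<Longrightarrow> p i x = 0" if "i \<in> ?J" for i
    using p[OF that] that by (auto simp: V_sub_def)
  have "(\<Sum>i\<in>?J. at_form P dt (p i) u) = (LINT x|?M. (\<Sum>i\<in>?J. density dt (p i) u x))"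
    using at_form_density[OF pV u] by (subst Bochner_Integration.integral_sum) auto
  also have "\<dots> \<le> (LINT x|?M. (\<Sum>i\<in>?J. density dt (p i) (p i) x) / 2 + real m * density dt u u x / 2)"
  proof (rule integral_mono_AE)
    show "integrable ?M (\<lambda>x. \<Sum>i\<in>?J. density dt (p i) u x)"
      using at_form_density[OF pV u] by (intro Bochner_Integration.integrable_sum) auto
    show "integrable ?M (\<lambda>x. (\<Sum>i\<in>?J. density dt (p i) (p i) x) / 2 + real m * density dt u u x / 2)"
      using at_form_density[OF pV pV] at_form_density[OF u u] by (intro Bochner_Integration.integrable_add
          Bochner_Integration.integrable_divide Bochner_Integration.integrable_sum integrable_mult_right) auto
    show "AE x in ?M. (\<Sum>i\<in>?J. density dt (p i) u x) \<le> (\<Sum>i\<in>?J. density dt (p i) (p i) x) / 2 + real m * density dt u u x / 2"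
      using AE_good coefficient(3)
    proof eventually_elim
      case (elim x)
      have half_aux: "a \<le> b / 2 + c / 2 \<Longrightarrow> d \<le> e / 2 + f / 2 \<Longrightarrow> a + d - (b + e) / 2 \<le> (c + f) / 2"
        for a b c d e f :: real by (simp add: field_simps)
      have k: "0 \<le> \<kappa> P x" using elim coefficient(2) by simp
      have x: "x \<in> \<Omega> P" using elim by (simp add: good_def)
      have nn: "0 \<le> density dt v v x" for v using k dt by (simp add: density_def)
      \<comment> \<open>After half of the own energy of \<open>p i\<close> is subtracted, each term
        is bounded by a quantity independent of \<open>i\<close>, as the counting lemma
        requires.\<close>
      have "(\<Sum>i\<in>?J. density dt (p i) u x - density dt (p i) (p i) x / 2) \<le> real m * (density dt u u x / 2)"
      proof (rule sum_overlap[OF x])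
        fix i assume i: "i \<in> ?J"
        have "dt * (\<kappa> P x * inner (grad (p i) x) (grad u x))
            \<le> dt * (\<kappa> P x * (inner (grad (p i) x) (grad (p i) x) / 2 + inner (grad u x) (grad u x) / 2))"
          using k dt by (intro mult_left_mono inner_le_half_squares) auto
        then have "dt * (\<kappa> P x * inner (grad (p i) x) (grad u x))
            \<le> dt * (\<kappa> P x * inner (grad (p i) x) (grad (p i) x)) / 2 + dt * (\<kappa> P x * inner (grad u x) (grad u x)) / 2"
          by (simp add: distrib_left)
        moreover have "p i x * u x \<le> p i x * p i x / 2 + u x * u x / 2"
          using inner_le_half_squares[of "p i x" "u x"] by simp
        ultimately show "density dt (p i) u x - density dt (p i) (p i) x / 2 \<le> density dt u u x / 2"
          unfolding density_def by (rule half_aux)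
        assume nx: "x \<notin> \<omega> P i"
        have "grad (p i) x = 0" using i elim(1) nx p0[OF i] by (intro grad_zero_off_omega) auto
        then show "density dt (p i) u x - density dt (p i) (p i) x / 2 \<le> 0"
          using p0[OF i nx] by (simp add: density_def)
      qed (use nn in auto)
      then show ?case by (simp add: sum_subtractf sum_divide_distrib)
    qed
  qed
  also have "\<dots> = (\<Sum>i\<in>?J. at_form P dt (p i) (p i)) / 2 + real m * at_form P dt u u / 2"
    using at_form_density[OF pV pV] at_form_density[OF u u]
    by (subst Bochner_Integration.integral_add)
      (auto intro!: Bochner_Integration.integrable_divide Bochner_Integration.integrable_sum integrable_mult_right simp: Bochner_Integration.integral_sum)
  finally show ?thesis .
qed

text \<open>Interpolation brings the piecewise quadratic product back into the fine space.\<close>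

definition local_part :: "(real ^ 'd \<Rightarrow> real) \<Rightarrow> nat \<Rightarrow> real ^ 'd \<Rightarrow> real" where
  "local_part w i = nodal_interpolant (fine_elems P) (\<lambda>x. pou P i x * w x)"

lemma pou_V_h: "i \<in> {1..N P} \<Longrightarrow> pou P i \<in> V_h P"
  using partition_of_unity(1) by blast

lemma local_part_V_h: "local_part w i \<in> V_h P"
  and local_part_vertex: "q \<in> vertices (fine_elems P) \<Longrightarrow> local_part w i q = pou P i q * w q"
  using nodal_interpolant_P1[OF tri] nodal_interpolant_vertex[OF tri] by (simp_all add: local_part_def V_h_def)

lemma vertex_closure: "q \<in> vertices (fine_elems P) \<Longrightarrow> q \<in> closure (\<Omega> P)"
  unfolding closure_Omega by (auto simp: vertices_def extreme_point_of_def)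

lemma local_part_V_sub:
  assumes i: "i \<in> {1..N P}" and w: "w \<in> V_h0 P"
  shows "local_part w i \<in> V_sub P i"
proof -
  have "local_part w i x = 0" if "x \<notin> \<omega> P i" for x
  proof (rule P1_vanishes_outside[OF tri patch_subset[OF i]])
    show "local_part w i \<in> P1 (fine_elems P)" using local_part_V_h by (simp add: V_h_def)
    show "x \<notin> interior (\<Union>(patch i))" using that by (simp add: omega_patch)
    fix q assume q: "q \<in> vertices (fine_elems P)" "q \<notin> interior (\<Union>(patch i))"
    \<comment> \<open>The cut-off is known to vanish only on the part of the domain outside
      \<open>\<omega> P i\<close>; at vertices on the boundary of the domain it is \<open>w\<close>
      that vanishes.\<close>
    have "pou P i q * w q = 0"
      using q(2) i partition_of_unity(1) V_h0_zero_outside[OF w, of q]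
      by (cases "q \<in> \<Omega> P") (auto simp: omega_patch)
    then show "local_part w i q = 0" using local_part_vertex[OF q(1)] by simp
  qed
  then show ?thesis using i local_part_V_h by (simp add: V_sub_def)
qed

text \<open>Both sides are fine functions, so agreement at vertices suffices. There the cut-offs sum
  to 1, also at boundary vertices because the assumption covers the closure.\<close>

lemma sum_local_part:
  assumes w: "w \<in> V_h P"
  shows "w = (\<lambda>x. \<Sum>i\<in>{1..N P}. local_part w i x)"
proof -
  have "(\<Sum>i\<in>I. local_part w i) \<in> V_h P" if "finite I" for I
    using that
  proof (induction I rule: finite_induct)
    case empty
    show ?case unfolding sum.empty by (rule V_h_zero)
  next
    case (insert j I)
    have "(\<Sum>i\<in>insert j I. local_part w i) = local_part w j + (\<Sum>i\<in>I. local_part w i)"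
      using insert by (intro sum.insert)
    then show ?case using V_h_add[OF local_part_V_h[of w j] insert.IH] by argo
  qed
  from this[of "{1..N P}"] have "w = (\<Sum>i\<in>{1..N P}. local_part w i)"
    using w unfolding V_h_def
  proof (intro P1_ext[OF tri])
    fix q assume q: "q \<in> vertices (fine_elems P)"
    have "(\<Sum>i\<in>{1..N P}. local_part w i) q = (\<Sum>i\<in>{1..N P}. pou P i q) * w q"
      using local_part_vertex[OF q] by (simp add: sum_fun_apply sum_distrib_right)
    then show "w q = (\<Sum>i\<in>{1..N P}. local_part w i) q"
      using partition_of_unity(2) vertex_closure[OF q] by simp
  qed auto
  then show ?thesis by (metis sum_fun_apply)
qed

text \<open>The barycentric weights at \<open>x\<close> do not depend on \<open>i\<close>. After
  Jensen's inequality the sums can be exchanged, and the squares of the cut-offs sum to at most 1 at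
  each vertex, so neither the overlap nor the number of subdomains enters.\<close>

lemma sum_local_part_square:
  assumes T: "T \<in> fine_elems P" "x \<in> T" and B: "\<And>y. y \<in> T \<Longrightarrow> (w y)\<^sup>2 \<le> B"
  shows "(\<Sum>i\<in>{1..N P}. (local_part w i x)\<^sup>2) \<le> B"
proof -
  obtain C u where C: "finite C" "C \<subseteq> vertices (fine_elems P) \<inter> T" "\<And>p. p \<in> C \<Longrightarrow> 0 \<le> u p" "sum u C = 1"
    "x = (\<Sum>p\<in>C. u p *\<^sub>R p)" and ev: "\<And>v. v \<in> P1 (fine_elems P) \<Longrightarrow> v x = (\<Sum>p\<in>C. u p * v p)"
    using P1_barycentric[OF tri T] by blast
  have vC: "\<And>p. p \<in> C \<Longrightarrow> p \<in> vertices (fine_elems P)" "\<And>p. p \<in> C \<Longrightarrow> p \<in> T" using C(2) by auto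
  have "(local_part w i x)\<^sup>2 \<le> (\<Sum>p\<in>C. u p * (pou P i p * w p)\<^sup>2)" for i
  proof -
    have "local_part w i x = (\<Sum>p\<in>C. u p * local_part w i p)"
      using ev local_part_V_h by (simp add: V_h_def)
    also have "\<dots> = (\<Sum>p\<in>C. u p * (pou P i p * w p))"
      using vC local_part_vertex by (intro sum.cong) auto
    finally show ?thesis using square_convex_sum[OF C(1,3,4)] by simp
  qed
  then have "(\<Sum>i\<in>{1..N P}. (local_part w i x)\<^sup>2) \<le> (\<Sum>i\<in>{1..N P}. \<Sum>p\<in>C. u p * (pou P i p * w p)\<^sup>2)"
    by (intro sum_mono) auto
  also have "\<dots> = (\<Sum>p\<in>C. u p * ((\<Sum>i\<in>{1..N P}. (pou P i p)\<^sup>2) * (w p)\<^sup>2))"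
    by (subst sum.swap) (simp add: power_mult_distrib sum_distrib_left sum_distrib_right)
  also have "\<dots> \<le> (\<Sum>p\<in>C. u p * B)"
  proof (intro sum_mono mult_left_mono C(3))
    fix p assume p: "p \<in> C"
    have "(\<Sum>i\<in>{1..N P}. (pou P i p)\<^sup>2) \<le> 1"
      using partition_of_unity(3) vertex_closure[OF vC(1)[OF p]] by blast
    then have "(\<Sum>i\<in>{1..N P}. (pou P i p)\<^sup>2) * (w p)\<^sup>2 \<le> 1 * (w p)\<^sup>2" by (rule mult_right_mono) simp
    then show "(\<Sum>i\<in>{1..N P}. (pou P i p)\<^sup>2) * (w p)\<^sup>2 \<le> B" using B[OF vC(2)[OF p]] by simp
  qed
  also have "\<dots> = B" using C(4) by (simp flip: sum_distrib_right)
  finally show ?thesis .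
qed

text \<open>On each element the squares sum pointwise to at most the maximum of the square of
  \<open>w\<close>; \<open>affine_sup_le_integral\<close> returns from this maximum to the integral,
  at the cost of a factor depending on the dimension only.\<close>

lemma L2_local_parts:
  assumes w: "w \<in> V_h P"
  shows "(\<Sum>i\<in>{1..N P}. L2_form P (local_part w i) (local_part w i)) \<le> 4 ^ (CARD('d) + 1) * L2_form P w w"
proof -
  let ?J = "{1..N P}" and ?K = "4 ^ (CARD('d) + 1) :: real"
  have int: "integrable (lebesgue_on (\<Omega> P)) (\<lambda>x. (v x)\<^sup>2)" if "v \<in> V_h P" for v
    using integrable_mult[OF that that] by (simp add: power2_eq_square)
  have L2: "L2_form P v v = (\<Sum>T\<in>fine_elems P. LINT x|lebesgue_on (interior T). (v x)\<^sup>2)" if "v \<in> V_h P" for v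
    using integral_split(2)[OF int[OF that]] by (simp add: L2_form_def power2_eq_square)
  have loc: "(\<Sum>i\<in>?J. LINT x|lebesgue_on (interior T). (local_part w i x)\<^sup>2) \<le> ?K * (LINT x|lebesgue_on (interior T). (w x)\<^sup>2)"
    if T: "T \<in> fine_elems P" for T
  proof (cases "T = {}")
    case False
    have cont: "continuous_on T (\<lambda>x. (w x)\<^sup>2)"
      using w T by (intro continuous_on_power) (auto simp: V_h_def P1_def intro: continuous_on_subset)
    obtain p where p: "p \<in> T" "\<And>y. y \<in> T \<Longrightarrow> (w y)\<^sup>2 \<le> (w p)\<^sup>2"
      using continuous_attains_sup[OF fine_compact[OF T] False cont] by blast
    obtain b c where bc: "\<forall>y\<in>T. w y = inner b y + c" using P1_affine w T unfolding V_h_def by blast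
    have fm: "interior T \<in> lmeasurable"
      using fine_compact[OF T] compact_imp_bounded lmeasurable_interior by blast
    interpret finite_measure "lebesgue_on (interior T)" using fm by (rule finite_measure_lebesgue_on)
    have intT: "integrable (lebesgue_on (interior T)) (\<lambda>x. (local_part w i x)\<^sup>2)" for i
      using integral_split(1)[OF int T] local_part_V_h by blast
    have "(\<Sum>i\<in>?J. LINT x|lebesgue_on (interior T). (local_part w i x)\<^sup>2)
        = (LINT x|lebesgue_on (interior T). (\<Sum>i\<in>?J. (local_part w i x)\<^sup>2))"
      using intT by (intro Bochner_Integration.integral_sum[symmetric]) auto
    also have "\<dots> \<le> (LINT x|lebesgue_on (interior T). (w p)\<^sup>2)"
    proof (rule integral_mono)
      fix x assume "x \<in> space (lebesgue_on (interior T))"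
      then have "x \<in> T" using interior_subset by (auto simp: space_restrict_space)
      then show "(\<Sum>i\<in>?J. (local_part w i x)\<^sup>2) \<le> (w p)\<^sup>2"
        using p(2) by (intro sum_local_part_square[OF T]) auto
    qed (use intT in auto)
    also have "\<dots> = measure lebesgue (interior T) * (w p)\<^sup>2"
      using fm by (simp add: measure_restrict_space space_restrict_space fmeasurableD)
    also have "\<dots> \<le> ?K * (LINT x|lebesgue_on (interior T). (w x)\<^sup>2)"
      using fine_compact[OF T] fine_convex[OF T] bc p(1) integral_split(1)[OF int[OF w] T]
      by (rule affine_sup_le_integral)
    finally show ?thesis .
  qed auto
  have "(\<Sum>i\<in>?J. L2_form P (local_part w i) (local_part w i))
      = (\<Sum>T\<in>fine_elems P. \<Sum>i\<in>?J. LINT x|lebesgue_on (interior T). (local_part w i x)\<^sup>2)"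
    using L2[OF local_part_V_h] by (subst sum.swap) simp
  also have "\<dots> \<le> (\<Sum>T\<in>fine_elems P. ?K * (LINT x|lebesgue_on (interior T). (w x)\<^sup>2))"
    using loc by (rule sum_mono)
  also have "\<dots> = ?K * L2_form P w w" using L2[OF w] by (simp add: sum_distrib_left)
  finally show ?thesis .
qed

lemma a_local_part:
  assumes "i \<in> {1..N P}" "w \<in> V_h P"
  shows "a_form P (local_part w i) (local_part w i)
    \<le> C\<^sub>I\<^sup>2 * a_form P (\<lambda>x. pou P i x * w x) (\<lambda>x. pou P i x * w x)"
proof -
  let ?g = "\<lambda>x. pou P i x * w x"
  have "?g \<in> P2 (fine_elems P)"
    using assms pou_V_h by (intro P2_mult) (auto simp: V_h_def)
  then have "sqrt (a_form P (local_part w i) (local_part w i)) \<le> C\<^sub>I * sqrt (a_form P ?g ?g)"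
    using interpolation unfolding local_part_def form_norm_def by blast
  then have "(sqrt (a_form P (local_part w i) (local_part w i)))\<^sup>2 \<le> (C\<^sub>I * sqrt (a_form P ?g ?g))\<^sup>2"
    by (intro power_mono) (simp_all add: a_form_nonneg)
  then show ?thesis by (simp add: power_mult_distrib a_form_nonneg)
qed

text \<open>The product rule gives two terms per cut-off. In one, the squared cut-offs sum to at
  most 1. In the other, the gradients of the cut-offs vanish almost everywhere off
  \<open>\<omega> P i\<close>, so at most \<open>m\<close> of them meet at a point; their bound
  carries the inverse square of the coarse size that turns the weighted integral into
  \<open>s_form\<close>.\<close>

lemma a_cutoffs:
  assumes w: "w \<in> V_h P"
  shows "(\<Sum>i\<in>{1..N P}. a_form P (\<lambda>x. pou P i x * w x) (\<lambda>x. pou P i x * w x))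
    \<le> 2 * a_form P w w + 2 * real m * C\<^sub>\<chi>\<^sup>2 * s_form P w w"
proof -
  let ?J = "{1..N P}" and ?M = "lebesgue_on (\<Omega> P)"
  let ?f = "\<lambda>i x. 2 * (pou P i x)\<^sup>2 * (norm (grad w x))\<^sup>2 + 2 * (w x)\<^sup>2 * (norm (grad (pou P i) x))\<^sup>2"
  have intF: "integrable ?M (\<lambda>x. \<kappa> P x * ?f i x)" if i: "i \<in> ?J" for i
  proof -
    obtain A where A: "\<forall>x. \<bar>pou P i x\<bar> \<le> A" using V_h_bounded[OF pou_V_h[OF i]] by blast
    obtain B where B: "\<forall>x. \<bar>w x\<bar> \<le> B" using V_h_bounded[OF w] by blast
    obtain C where C: "\<forall>x\<in>U. norm (grad (pou P i) x) \<le> C" using grad_bounded[OF pou_V_h[OF i]] by blast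
    obtain D where D: "\<forall>x\<in>U. norm (grad w x) \<le> D" using grad_bounded[OF w] by blast
    have "AE x in ?M. \<bar>?f i x\<bar> \<le> 2 * A\<^sup>2 * D\<^sup>2 + 2 * B\<^sup>2 * C\<^sup>2"
      using AE_U
    proof eventually_elim
      case (elim x)
      have "(pou P i x)\<^sup>2 \<le> A\<^sup>2" "(w x)\<^sup>2 \<le> B\<^sup>2"
        using A B power_mono[of "\<bar>pou P i x\<bar>" A 2] power_mono[of "\<bar>w x\<bar>" B 2] by simp_all
      moreover have "(norm (grad w x))\<^sup>2 \<le> D\<^sup>2" "(norm (grad (pou P i) x))\<^sup>2 \<le> C\<^sup>2"
        using C D elim by (auto intro!: power_mono)
      ultimately have "(pou P i x)\<^sup>2 * (norm (grad w x))\<^sup>2 \<le> A\<^sup>2 * D\<^sup>2"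
        "(w x)\<^sup>2 * (norm (grad (pou P i) x))\<^sup>2 \<le> B\<^sup>2 * C\<^sup>2"
        by (auto intro!: mult_mono)
      then show ?case by (simp add: mult.assoc)
    qed
    moreover have "?f i \<in> borel_measurable ?M"
      using V_h_measurable[OF w] V_h_measurable[OF pou_V_h[OF i]] grad_measurable[OF w] grad_measurable[OF pou_V_h[OF i]]
      by measurable
    ultimately show ?thesis by (rule integrable_bounded_AE(2)[rotated])
  qed
  have sqle: "(norm (a + b))\<^sup>2 \<le> 2 * (norm a)\<^sup>2 + 2 * (norm b)\<^sup>2" for a b :: "real ^ 'd"
  proof -
    have "0 \<le> (norm (a - b))\<^sup>2" by simp
    then show ?thesis by (simp add: power2_norm_eq_inner inner_add_left inner_add_right inner_diff_left inner_diff_right)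
  qed
  have each: "a_form P (\<lambda>x. pou P i x * w x) (\<lambda>x. pou P i x * w x) \<le> (LINT x|?M. \<kappa> P x * ?f i x)"
    if i: "i \<in> ?J" for i
    unfolding a_form_def
  \<comment> \<open>Monotonicity in the variant that asks for integrability of the nonnegative
    majorant only.\<close>
  proof (rule integral_mono_AE'[OF intF[OF i]])
    show "AE x in ?M. \<kappa> P x * inner (grad (\<lambda>x. pou P i x * w x) x) (grad (\<lambda>x. pou P i x * w x) x) \<le> \<kappa> P x * ?f i x"
      using AE_U coefficient(3)
    proof eventually_elim
      case (elim x)
      have "inner (grad (\<lambda>x. pou P i x * w x) x) (grad (\<lambda>x. pou P i x * w x) x) \<le> ?f i x"
        using grad_mult[OF pou_V_h[OF i] w elim(1)] sqle[of "pou P i x *\<^sub>R grad w x" "w x *\<^sub>R grad (pou P i) x"]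
        by (simp add: power_mult_distrib flip: power2_norm_eq_inner)
      then show ?case using elim coefficient(2) by (intro mult_left_mono) auto
    qed
    show "AE x in ?M. 0 \<le> \<kappa> P x * ?f i x"
      using coefficient(3) by eventually_elim (use coefficient(2) in auto)
  qed
  let ?h = "\<lambda>x. 2 * (\<kappa> P x * inner (grad w x) (grad w x)) + 2 * real m * (C\<^sub>\<chi> / coarse_size P)\<^sup>2 * (\<kappa> P x * (w x * w x))"
  have "(\<Sum>i\<in>?J. a_form P (\<lambda>x. pou P i x * w x) (\<lambda>x. pou P i x * w x)) \<le> (\<Sum>i\<in>?J. LINT x|?M. \<kappa> P x * ?f i x)"
    using each by (rule sum_mono)
  also have "\<dots> = (LINT x|?M. (\<Sum>i\<in>?J. \<kappa> P x * ?f i x))"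
    using intF by (intro Bochner_Integration.integral_sum[symmetric])
  also have "\<dots> \<le> (LINT x|?M. ?h x)"
  proof (rule integral_mono_AE)
    show "integrable ?M (\<lambda>x. \<Sum>i\<in>?J. \<kappa> P x * ?f i x)" using intF by (rule Bochner_Integration.integrable_sum)
    show "integrable ?M ?h" using integrable_V_h[OF w w] by (intro Bochner_Integration.integrable_add integrable_mult_right)
    have "AE x in ?M. \<forall>i\<in>?J. norm (grad (pou P i) x) \<le> C\<^sub>\<chi> / coarse_size P"
      using partition_of_unity(4) by (subst AE_finite_all) auto
    then show "AE x in ?M. (\<Sum>i\<in>?J. \<kappa> P x * ?f i x) \<le> ?h x"
      using AE_good coefficient(3)
    proof eventually_elim
      case (elim x)
      have k: "0 \<le> \<kappa> P x" using elim coefficient(2) by simp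
      have x: "x \<in> \<Omega> P" using elim by (simp add: good_def)
      have "(\<Sum>i\<in>?J. (norm (grad (pou P i) x))\<^sup>2) \<le> real m * (C\<^sub>\<chi> / coarse_size P)\<^sup>2"
      proof (rule sum_overlap[OF x])
        fix i assume i: "i \<in> ?J"
        show "(norm (grad (pou P i) x))\<^sup>2 \<le> (C\<^sub>\<chi> / coarse_size P)\<^sup>2" using elim(1) i by (intro power_mono) auto
        assume "x \<notin> \<omega> P i"
        then have "grad (pou P i) x = 0"
          using i elim(2) partition_of_unity(1) by (intro grad_zero_off_omega) auto
        then show "(norm (grad (pou P i) x))\<^sup>2 \<le> 0" by simp
      qed auto
      moreover have "(\<Sum>i\<in>?J. (pou P i x)\<^sup>2) \<le> 1" using partition_of_unity(3) x closure_subset by blast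
      ultimately have "2 * (\<Sum>i\<in>?J. (pou P i x)\<^sup>2) * (norm (grad w x))\<^sup>2 + 2 * (w x)\<^sup>2 * (\<Sum>i\<in>?J. (norm (grad (pou P i) x))\<^sup>2)
         \<le> 2 * 1 * (norm (grad w x))\<^sup>2 + 2 * (w x)\<^sup>2 * (real m * (C\<^sub>\<chi> / coarse_size P)\<^sup>2)"
        by (intro add_mono mult_right_mono mult_left_mono) auto
      then have "\<kappa> P x * (2 * (\<Sum>i\<in>?J. (pou P i x)\<^sup>2) * (norm (grad w x))\<^sup>2 + 2 * (w x)\<^sup>2 * (\<Sum>i\<in>?J. (norm (grad (pou P i) x))\<^sup>2))
         \<le> \<kappa> P x * (2 * 1 * (norm (grad w x))\<^sup>2 + 2 * (w x)\<^sup>2 * (real m * (C\<^sub>\<chi> / coarse_size P)\<^sup>2))"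
        using k by (rule mult_left_mono)
      moreover have "(\<Sum>i\<in>?J. \<kappa> P x * ?f i x)
         = \<kappa> P x * (2 * (\<Sum>i\<in>?J. (pou P i x)\<^sup>2) * (norm (grad w x))\<^sup>2 + 2 * (w x)\<^sup>2 * (\<Sum>i\<in>?J. (norm (grad (pou P i) x))\<^sup>2))"
        by (simp add: sum.distrib sum_distrib_left sum_distrib_right distrib_left mult.assoc)
      moreover have "?h x = \<kappa> P x * (2 * 1 * (norm (grad w x))\<^sup>2 + 2 * (w x)\<^sup>2 * (real m * (C\<^sub>\<chi> / coarse_size P)\<^sup>2))"
        unfolding power2_norm_eq_inner by (simp add: power2_eq_square algebra_simps)
      ultimately show ?case by simp
    qed
  qed
  also have "\<dots> = 2 * a_form P w w + 2 * real m * (C\<^sub>\<chi> / coarse_size P)\<^sup>2 * (LINT x|?M. \<kappa> P x * (w x * w x))"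
    using integrable_V_h[OF w w] by (simp add: a_form_def)
  also have "\<dots> = 2 * a_form P w w + 2 * real m * C\<^sub>\<chi>\<^sup>2 * s_form P w w"
    by (simp add: s_form_def power_divide)
  finally show ?thesis .
qed

text \<open>The approximation property converts \<open>s_form\<close> into \<open>a_form\<close>, so
  each of the two parts of the norm is controlled by itself; adding the two constants bounds both
  for any weight \<open>dt\<close>. No sign of \<open>C\<^sub>A\<close> is assumed, hence its
  absolute value.\<close>

lemma at_local_parts:
  assumes w: "w \<in> V_h P" and dt: "0 < dt" and CA: "s_form P w w \<le> C\<^sub>A * a_form P w w"
  shows "(\<Sum>i\<in>{1..N P}. at_form P dt (local_part w i) (local_part w i))
    \<le> (2 * C\<^sub>I\<^sup>2 * (1 + real m * C\<^sub>\<chi>\<^sup>2 * \<bar>C\<^sub>A\<bar>) + 4 ^ (CARD('d) + 1)) * at_form P dt w w"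
proof -
  let ?J = "{1..N P}" and ?A = "2 * C\<^sub>I\<^sup>2 * (1 + real m * C\<^sub>\<chi>\<^sup>2 * \<bar>C\<^sub>A\<bar>)" and ?K = "4 ^ (CARD('d) + 1) :: real"
  have s: "s_form P w w \<le> \<bar>C\<^sub>A\<bar> * a_form P w w"
    using CA by (rule order_trans) (intro mult_right_mono a_form_nonneg, simp)
  have "(\<Sum>i\<in>?J. a_form P (local_part w i) (local_part w i))
      \<le> (\<Sum>i\<in>?J. C\<^sub>I\<^sup>2 * a_form P (\<lambda>x. pou P i x * w x) (\<lambda>x. pou P i x * w x))"
    using a_local_part w by (intro sum_mono) auto
  also have "\<dots> \<le> C\<^sub>I\<^sup>2 * (2 * a_form P w w + 2 * real m * C\<^sub>\<chi>\<^sup>2 * s_form P w w)"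
    unfolding sum_distrib_left[symmetric] by (intro mult_left_mono a_cutoffs w) simp
  also have "\<dots> \<le> C\<^sub>I\<^sup>2 * (2 * a_form P w w + 2 * real m * C\<^sub>\<chi>\<^sup>2 * (\<bar>C\<^sub>A\<bar> * a_form P w w))"
    by (intro mult_left_mono add_left_mono s) auto
  also have "\<dots> = ?A * a_form P w w" by (simp add: algebra_simps)
  finally have a: "dt * (\<Sum>i\<in>?J. a_form P (local_part w i) (local_part w i)) \<le> dt * (?A * a_form P w w)"
    using dt by simp
  have "(\<Sum>i\<in>?J. at_form P dt (local_part w i) (local_part w i))
      = dt * (\<Sum>i\<in>?J. a_form P (local_part w i) (local_part w i)) + (\<Sum>i\<in>?J. L2_form P (local_part w i) (local_part w i))"
    by (simp add: at_form_def sum.distrib sum_distrib_left)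
  also have "\<dots> \<le> dt * (?A * a_form P w w) + ?K * L2_form P w w"
    using a L2_local_parts[OF w] by simp
  also have "\<dots> \<le> (?A + ?K) * at_form P dt w w"
  proof -
    have "0 \<le> ?A * L2_form P w w" "0 \<le> ?K * (dt * a_form P w w)"
      using dt L2_form_nonneg[of w] a_form_nonneg[of w] by (auto intro!: mult_nonneg_nonneg add_nonneg_nonneg)
    then show ?thesis by (simp add: at_form_def algebra_simps)
  qed
  finally show ?thesis .
qed

end

section \<open>Stable decomposition\<close>

lemma span_eq_range_sum:
  assumes "distinct bs"
  shows "fun_vs.span (set bs) = range (\<lambda>u z. \<Sum>j<length bs. u j * (bs ! j) z)"
proof -
  have reindex: "(\<Sum>v\<in>set bs. fscale (u v) v) = (\<lambda>z. \<Sum>j<length bs. u (bs ! j) * (bs ! j) z)" for u :: "_ \<Rightarrow> real"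
  proof
    fix z
    show "(\<Sum>v\<in>set bs. fscale (u v) v) z = (\<Sum>j<length bs. u (bs ! j) * (bs ! j) z)"
      unfolding sum_fun_apply
      by (rule sum.reindex_bij_betw[symmetric, OF bij_betw_nth[OF assms refl refl]])
  qed
  have "\<exists>u'. (\<lambda>z. \<Sum>j<length bs. u j * (bs ! j) z) = (\<Sum>v\<in>set bs. fscale (u' v) v)" for u :: "nat \<Rightarrow> real"
  proof -
    define u' where "u' v = u (the_inv_into {..<length bs} ((!) bs) v)" for v
    have "u' (bs ! j) = u j" if "j < length bs" for j
      using that inj_on_nth[OF assms, of "{..<length bs}"] by (simp add: u'_def the_inv_into_f_f)
    then show ?thesis unfolding reindex by (intro exI[of _ u']) simp
  qed
  then show ?thesis unfolding fun_vs.span_finite[OF finite_set] using reindex by (auto simp: image_iff)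
qed

text \<open>Supplies the injectivity of the inclusion matrix. The coefficients are transferred from
  list positions to list members, which \<open>distinct\<close> makes unambiguous.\<close>

lemma independent_sum_zero:
  assumes "distinct bs" "\<not> fun_vs.dependent (set bs)"
    and "(\<lambda>z. \<Sum>j<length bs. u j * (bs ! j) z) = 0" "j < length bs"
  shows "u j = 0"
proof -
  define u' where "u' v = u (the_inv_into {..<length bs} ((!) bs) v)" for v
  have u': "u' (bs ! j) = u j" if "j < length bs" for j
    using that inj_on_nth[OF assms(1), of "{..<length bs}"] by (simp add: u'_def the_inv_into_f_f)
  have "(\<Sum>v\<in>set bs. fscale (u' v) v) = 0"
  proof
    fix z
    have "(\<Sum>v\<in>set bs. fscale (u' v) v) z = (\<Sum>j<length bs. u' (bs ! j) * (bs ! j) z)"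
      unfolding sum_fun_apply
      by (rule sum.reindex_bij_betw[symmetric, OF bij_betw_nth[OF assms(1) refl refl]])
    also have "\<dots> = 0" using fun_cong[OF assms(3), of z] u' by simp
    finally show "(\<Sum>v\<in>set bs. fscale (u' v) v) z = 0 z" by simp
  qed
  then have "u' (bs ! j) = 0"
    using fun_vs.independentD[OF assms(2) finite_set subset_refl, of u' "bs ! j"] assms(4) by simp
  then show ?thesis using u' assms(4) by simp
qed

context two_level_setting
begin

lemma at_form_sym: "at_form P dt u v = at_form P dt v u"
  using a_form_sym L2_form_sym by (simp add: at_form_def)

lemma at_form_add: "u \<in> V_h P \<Longrightarrow> v \<in> V_h P \<Longrightarrow> w \<in> V_h P \<Longrightarrow>
    at_form P dt (u + v) w = at_form P dt u w + at_form P dt v w"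
  by (simp only: at_form_def a_form_add L2_form_add distrib_left ac_simps)

lemma at_form_scale: "u \<in> V_h P \<Longrightarrow> w \<in> V_h P \<Longrightarrow> at_form P dt (fscale c u) w = c * at_form P dt u w"
  by (simp only: at_form_def a_form_scale L2_form_scale) (simp add: distrib_left)

lemma at_form_nonneg: "0 < dt \<Longrightarrow> 0 \<le> at_form P dt u u"
  using a_form_nonneg[of u] L2_form_nonneg[of u] by (simp add: at_form_def)

lemma at_form_zero: "w \<in> V_h P \<Longrightarrow> at_form P dt (\<lambda>z. 0) w = 0"
  using at_form_scale[OF V_h_zero, of w dt 0] by simp

lemma at_form_lincomb:
  assumes "w \<in> V_h P" "\<And>i. i \<in> I \<Longrightarrow> f i \<in> V_h0 P"
  shows "at_form P dt (\<lambda>z. \<Sum>i\<in>I. c i * f i z) w = (\<Sum>i\<in>I. c i * at_form P dt (f i) w)"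
  using assms(2)
proof (induction I rule: infinite_finite_induct)
  case (insert j I)
  have "(\<lambda>z. \<Sum>i\<in>insert j I. c i * f i z) = fscale (c j) (f j) + (\<lambda>z. \<Sum>i\<in>I. c i * f i z)"
    using insert by (simp add: plus_fun_def)
  moreover have "(\<lambda>z. \<Sum>i\<in>I. c i * f i z) \<in> V_h P"
    using insert by (intro V_h0_V_h V_h0_lincomb) auto
  ultimately show ?case
    using insert assms(1) V_h0_V_h[of "f j"] by (simp add: at_form_add at_form_scale V_h_scale)
qed (use assms(1) at_form_zero in simp_all)

lemma at_form_sum:
  assumes "w \<in> V_h P" "\<And>i. i \<in> I \<Longrightarrow> f i \<in> V_h0 P"
  shows "at_form P dt (\<lambda>z. \<Sum>i\<in>I. f i z) w = (\<Sum>i\<in>I. at_form P dt (f i) w)"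
  using at_form_lincomb[OF assms, where c = "\<lambda>_. 1" and dt = dt] assms by simp

text \<open>Expansion of the nonnegative energy of \<open>c * u - v\<close>. With \<open>c\<close>
  free it serves for bounding the remainder (\<open>-1\<close>), for the coarse projection
  (\<open>1\<close>) and for the absorption in the lower bound.\<close>

lemma at_form_young:
  assumes "0 < dt" "u \<in> V_h P" "v \<in> V_h P"
  shows "2 * c * at_form P dt u v \<le> c\<^sup>2 * at_form P dt u u + at_form P dt v v"
proof -
  let ?b = "at_form P dt"
  define u' v' where "u' = fscale c u" and "v' = fscale (-1) v"
  have V: "u' \<in> V_h P" "v' \<in> V_h P" unfolding u'_def v'_def by (rule V_h_scale[OF assms(2)], rule V_h_scale[OF assms(3)])
  have "?b u' w = c * ?b u w" "?b v' w = - ?b v w" if "w \<in> V_h P" for w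
    using at_form_scale[OF assms(2) that, of dt c] at_form_scale[OF assms(3) that, of dt "-1"]
    unfolding u'_def v'_def by simp_all
  note sc = this[OF assms(2)] this[OF assms(3)] this[OF V(1)] this[OF V(2)]
  have "0 \<le> ?b (u' + v') (u' + v')" using assms(1) by (rule at_form_nonneg)
  also have "\<dots> = ?b (u' + v') u' + ?b (u' + v') v'"
    using at_form_add[OF V V_h_add[OF V]] V at_form_sym by (metis)
  also have "\<dots> = ?b u' u' + 2 * ?b u' v' + ?b v' v'"
    using V by (simp add: at_form_add at_form_sym[of dt v' u'])
  also have "?b u' u' = c\<^sup>2 * ?b u u" using sc at_form_sym[of dt u u'] by (simp add: power2_eq_square)
  also have "?b u' v' = - c * ?b u v" using sc at_form_sym[of dt u v'] at_form_sym[of dt v u] by simp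
  also have "?b v' v' = ?b v v" using sc at_form_sym[of dt v v'] by simp
  finally show ?thesis by simp
qed

text \<open>A nonzero value at a point of an element forces positive mass on that element by
  \<open>affine_sup_le_integral\<close>, so the \<open>L2_form\<close> part alone is
  positive.\<close>

lemma at_form_pos:
  assumes "0 < dt" "u \<in> V_h P" "u \<noteq> 0"
  shows "0 < at_form P dt u u"
proof -
  let ?K = "4 ^ (CARD('d) + 1) :: real"
  obtain x where x: "u x \<noteq> 0" using assms(3) by (auto simp: fun_eq_iff)
  then have "x \<in> \<Union>(fine_elems P)" using assms(2) by (auto simp: V_h_def P1_def)
  then obtain T where T: "T \<in> fine_elems P" "x \<in> T" by blast
  obtain b c where bc: "\<forall>y\<in>T. u y = inner b y + c" using P1_affine T(1) assms(2) unfolding V_h_def by blast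
  have int: "integrable (lebesgue_on (\<Omega> P)) (\<lambda>x. (u x)\<^sup>2)"
    using integrable_mult[OF assms(2,2)] by (simp add: power2_eq_square)
  have "measure lebesgue (interior T) * (u x)\<^sup>2 \<le> ?K * (LINT y|lebesgue_on (interior T). (u y)\<^sup>2)"
    using fine_compact[OF T(1)] fine_convex[OF T(1)] bc T(2) integral_split(1)[OF int T(1)]
    by (rule affine_sup_le_integral)
  also have "\<dots> \<le> ?K * L2_form P u u"
  proof (rule mult_left_mono)
    have "(LINT y|lebesgue_on (interior T). (u y)\<^sup>2) \<le> (\<Sum>T\<in>fine_elems P. LINT y|lebesgue_on (interior T). (u y)\<^sup>2)"
      using finite_fine T(1) by (intro member_le_sum) (auto intro!: integral_nonneg_AE)
    then show "(LINT y|lebesgue_on (interior T). (u y)\<^sup>2) \<le> L2_form P u u"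
      using integral_split(2)[OF int] by (simp add: L2_form_def power2_eq_square)
  qed simp
  finally have le: "measure lebesgue (interior T) * (u x)\<^sup>2 \<le> ?K * L2_form P u u" .
  have "interior T \<noteq> {}" using fine_closure_interior[OF T(1)] T(2) by auto
  then have "\<not> negligible (interior T)" by (intro open_not_negligible) auto
  moreover have "interior T \<in> lmeasurable"
    using fine_compact[OF T(1)] compact_imp_bounded lmeasurable_interior by blast
  ultimately have "0 < measure lebesgue (interior T)"
    using negligible_iff_measure zero_less_measure_iff by (metis measure_nonneg order_le_less)
  then have "0 < measure lebesgue (interior T) * (u x)\<^sup>2" using x by simp
  then have "0 < ?K * L2_form P u u" using le by linarith
  then have "0 < L2_form P u u" by (simp add: zero_less_mult_iff)
  moreover have "0 \<le> dt * a_form P u u" using assms(1) a_form_nonneg[of u] by simp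
  ultimately show ?thesis by (simp add: at_form_def)
qed

lemma V_sub_V_h0: "i \<in> {0..N P} \<Longrightarrow> v \<in> V_sub P i \<Longrightarrow> v \<in> V_h0 P"
proof (cases "i = 0")
  case True
  assume "v \<in> V_sub P i"
  then obtain f g where "v = f + g" "f \<in> V_H1 P" "g \<in> W_H P" using True by (auto simp: V_sub_def V_0_def fsum_def)
  then show ?thesis using extra_coarse(1) by (auto simp: V_H1_def solves_coarse_def intro!: V_h0_add)
next
  case False
  assume "i \<in> {0..N P}" "v \<in> V_sub P i"
  then show ?thesis using False omega_subset[of i] by (auto simp: V_sub_def V_h0_iff)
qed

text \<open>The first summand pays for the coarse part. The factor
  \<open>2 * (1 + C\<^sub>0\<^sup>2)\<close> bounds the energy of the remainder by that of
  \<open>u\<close>, and the last factor is the constant of \<open>at_local_parts\<close>.\<close>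

definition stability_const :: "real \<Rightarrow> real \<Rightarrow> real" where
  "stability_const C\<^sub>0 C\<^sub>A = C\<^sub>0\<^sup>2 + 2 * (1 + C\<^sub>0\<^sup>2) *
    (2 * C\<^sub>I\<^sup>2 * (1 + real m * C\<^sub>\<chi>\<^sup>2 * \<bar>C\<^sub>A\<bar>) + 4 ^ (CARD('d) + 1))"

lemma stability_const_pos: "0 < stability_const C\<^sub>0 C\<^sub>A"
proof -
  have "0 < 2 * C\<^sub>I\<^sup>2 * (1 + real m * C\<^sub>\<chi>\<^sup>2 * \<bar>C\<^sub>A\<bar>) + 4 ^ (CARD('d) + 1)"
    by (intro add_nonneg_pos mult_nonneg_nonneg add_nonneg_nonneg) auto
  then have "0 < 2 * (1 + C\<^sub>0\<^sup>2) * (2 * C\<^sub>I\<^sup>2 * (1 + real m * C\<^sub>\<chi>\<^sup>2 * \<bar>C\<^sub>A\<bar>) + 4 ^ (CARD('d) + 1))"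
    by (intro mult_pos_pos) (auto intro: add_pos_nonneg)
  then show ?thesis by (simp add: stability_const_def add_nonneg_pos)
qed

lemma stable_decomposition:
  assumes dt: "0 < dt" and u: "u \<in> V_h0 P" and u0: "u0 \<in> V_sub P 0"
    and C0: "at_form P dt u0 u0 \<le> C\<^sub>0\<^sup>2 * at_form P dt u u"
    and CA: "s_form P (u - u0) (u - u0) \<le> C\<^sub>A * a_form P (u - u0) (u - u0)"
  obtains f where "\<And>i. i \<in> {0..N P} \<Longrightarrow> f i \<in> V_sub P i" "u = (\<lambda>z. \<Sum>i\<in>{0..N P}. f i z)"
    "(\<Sum>i\<in>{0..N P}. at_form P dt (f i) (f i)) \<le> stability_const C\<^sub>0 C\<^sub>A * at_form P dt u u"
proof -
  let ?b = "at_form P dt" and ?K = "2 * C\<^sub>I\<^sup>2 * (1 + real m * C\<^sub>\<chi>\<^sup>2 * \<bar>C\<^sub>A\<bar>) + 4 ^ (CARD('d) + 1)"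
  define w where "w = u - u0"
  have u0V: "u0 \<in> V_h0 P" using V_sub_V_h0[OF _ u0] by simp
  have w: "w \<in> V_h0 P" using V_h0_diff[OF u u0V] by (simp add: w_def)
  note V = V_h0_V_h[OF u] V_h0_V_h[OF u0V] V_h0_V_h[OF w]
  have K: "0 \<le> ?K" by (intro add_nonneg_nonneg mult_nonneg_nonneg) auto
  define f where "f i = (if i = 0 then u0 else local_part w i)" for i
  have split: "{0..N P} = insert 0 {1..N P}" by auto
  have "u z = u0 z + (\<Sum>i\<in>{1..N P}. local_part w i z)" for z
    using fun_cong[OF sum_local_part[OF V(3)], of z] by (simp add: w_def)
  then have "u = (\<lambda>z. \<Sum>i\<in>{0..N P}. f i z)" by (simp add: split f_def fun_eq_iff)
  moreover have "f i \<in> V_sub P i" if "i \<in> {0..N P}" for i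
    using that u0 local_part_V_sub[OF _ w, of i] by (simp add: f_def)
  moreover have "(\<Sum>i\<in>{0..N P}. ?b (f i) (f i)) \<le> stability_const C\<^sub>0 C\<^sub>A * ?b u u"
  proof -
    \<comment> \<open>The energy of a difference is at most twice the sum of the energies; the cross
      term is handled by Young's inequality with \<open>c = -1\<close>.\<close>
    have "?b w w \<le> 2 * ?b u u + 2 * ?b u0 u0"
    proof -
      have "u0 + w = u" by (simp add: w_def)
      then have 1: "?b u v = ?b u0 v + ?b w v" if "v \<in> V_h P" for v using at_form_add[OF V(2,3) that, of dt] by simp
      have "?b w w = ?b u u - 2 * ?b u0 u + ?b u0 u0"
        using 1[OF V(1)] 1[OF V(2)] 1[OF V(3)] at_form_sym[of dt u u0] at_form_sym[of dt u w] at_form_sym[of dt w u0] by linarith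
      moreover have "2 * (-1) * ?b u0 u \<le> (-1)\<^sup>2 * ?b u0 u0 + ?b u u" using at_form_young[OF dt V(2,1)] .
      ultimately show ?thesis by simp
    qed
    also have "\<dots> \<le> 2 * (1 + C\<^sub>0\<^sup>2) * ?b u u" using C0 by (simp add: algebra_simps)
    finally have wu: "?b w w \<le> 2 * (1 + C\<^sub>0\<^sup>2) * ?b u u" .
    have "(\<Sum>i\<in>{0..N P}. ?b (f i) (f i)) = ?b u0 u0 + (\<Sum>i\<in>{1..N P}. ?b (local_part w i) (local_part w i))"
      by (simp add: split f_def)
    also have "\<dots> \<le> C\<^sub>0\<^sup>2 * ?b u u + ?K * ?b w w"
      using CA by (intro add_mono C0 at_local_parts V(3) dt) (simp add: w_def)
    also have "\<dots> \<le> C\<^sub>0\<^sup>2 * ?b u u + ?K * (2 * (1 + C\<^sub>0\<^sup>2) * ?b u u)"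
      using wu K by (intro add_left_mono mult_left_mono)
    also have "\<dots> = stability_const C\<^sub>0 C\<^sub>A * ?b u u" by (simp add: stability_const_def algebra_simps)
    finally show ?thesis .
  qed
  ultimately show thesis using that by blast
qed

text \<open>For a projection, \<open>b (p i) u\<close> equals \<open>b (p i) (p i)\<close>, so the
  half on the right of \<open>at_form_overlap\<close> is absorbed. The coarse space overlaps
  everything and is treated alone, contributing the extra 1.\<close>

lemma projections_upper:
  assumes dt: "0 < dt" and u: "u \<in> V_h0 P"
    and p: "\<And>i. i \<in> {0..N P} \<Longrightarrow> p i \<in> V_sub P i"
    and orth: "\<And>i v. i \<in> {0..N P} \<Longrightarrow> v \<in> V_sub P i \<Longrightarrow> at_form P dt (p i) v = at_form P dt u v"
  shows "(\<Sum>i\<in>{0..N P}. at_form P dt (p i) (p i)) \<le> (real m + 1) * at_form P dt u u"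
proof -
  let ?b = "at_form P dt" and ?J = "{1..N P}"
  have uV: "u \<in> V_h P" using u by (rule V_h0_V_h)
  have eq: "?b (p i) u = ?b (p i) (p i)" if "i \<in> {0..N P}" for i
    using orth[OF that p[OF that]] at_form_sym by metis
  have "(\<Sum>i\<in>?J. ?b (p i) (p i)) = (\<Sum>i\<in>?J. ?b (p i) u)" using eq by (intro sum.cong) auto
  also have "\<dots> \<le> (\<Sum>i\<in>?J. ?b (p i) (p i)) / 2 + real m * ?b u u / 2"
    using p by (intro at_form_overlap dt uV) auto
  finally have "(\<Sum>i\<in>?J. ?b (p i) (p i)) \<le> real m * ?b u u" by simp
  moreover have "?b (p 0) (p 0) \<le> ?b u u"
  proof -
    have p0: "p 0 \<in> V_h P" using p[of 0] V_sub_V_h0[of 0] V_h0_V_h by simp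
    have "2 * 1 * ?b (p 0) u \<le> 1\<^sup>2 * ?b (p 0) (p 0) + ?b u u" using at_form_young[OF dt p0 uV] .
    then show ?thesis using eq[of 0] by simp
  qed
  moreover have "{0..N P} = insert 0 ?J" by auto
  ultimately show ?thesis by (simp add: distrib_right)
qed

text \<open>Orthogonality replaces \<open>u\<close> by \<open>p i\<close> when it is tested with
  \<open>f i\<close>. Young's inequality with weight \<open>C\<close> makes the energies of the
  decomposition cost exactly half of the left side \<open>2 * C * b u u\<close>.\<close>

lemma projections_lower:
  assumes dt: "0 < dt" and u: "u \<in> V_h0 P"
    and p: "\<And>i. i \<in> {0..N P} \<Longrightarrow> p i \<in> V_sub P i"
    and orth: "\<And>i v. i \<in> {0..N P} \<Longrightarrow> v \<in> V_sub P i \<Longrightarrow> at_form P dt (p i) v = at_form P dt u v"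
    and f: "\<And>i. i \<in> {0..N P} \<Longrightarrow> f i \<in> V_sub P i" "u = (\<lambda>z. \<Sum>i\<in>{0..N P}. f i z)"
    and stable: "(\<Sum>i\<in>{0..N P}. at_form P dt (f i) (f i)) \<le> C * at_form P dt u u" and C: "0 < C"
  shows "at_form P dt u u \<le> C * (\<Sum>i\<in>{0..N P}. at_form P dt (p i) (p i))"
proof -
  let ?b = "at_form P dt" and ?J = "{0..N P}"
  have V: "f i \<in> V_h0 P" "f i \<in> V_h P" "p i \<in> V_h P" if "i \<in> ?J" for i
    using V_sub_V_h0[OF that] f(1)[OF that] p[OF that] V_h0_V_h by blast+
  have "?b u u = (\<Sum>i\<in>?J. ?b (f i) u)"
    using at_form_sum[OF V_h0_V_h[OF u] V(1), of ?J "\<lambda>i. i" dt] f(2) by simp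
  also have "\<dots> = (\<Sum>i\<in>?J. ?b (p i) (f i))" using orth f(1) at_form_sym by (intro sum.cong) metis+
  finally have "2 * C * ?b u u = (\<Sum>i\<in>?J. 2 * C * ?b (p i) (f i))" by (simp add: sum_distrib_left)
  also have "\<dots> \<le> (\<Sum>i\<in>?J. C\<^sup>2 * ?b (p i) (p i) + ?b (f i) (f i))"
    using V by (intro sum_mono at_form_young dt) auto
  also have "\<dots> \<le> C\<^sup>2 * (\<Sum>i\<in>?J. ?b (p i) (p i)) + C * ?b u u"
    using stable by (simp add: sum.distrib sum_distrib_left)
  finally have "C * ?b u u \<le> C * (C * (\<Sum>i\<in>?J. ?b (p i) (p i)))" by (simp add: power2_eq_square algebra_simps)
  then show ?thesis using C by simp
qed

end

section \<open>Matrix form\<close>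

definition comb :: "('a \<Rightarrow> real) list \<Rightarrow> real Matrix.vec \<Rightarrow> 'a \<Rightarrow> real" where
  "comb \<Phi> x = (\<lambda>z. \<Sum>k<length \<Phi>. x $ k * (\<Phi> ! k) z)"

lemma comb_add: "x \<in> carrier_vec (length \<Phi>) \<Longrightarrow> y \<in> carrier_vec (length \<Phi>) \<Longrightarrow> comb \<Phi> (x + y) = comb \<Phi> x + comb \<Phi> y"
  by (simp add: comb_def fun_eq_iff distrib_right sum.distrib)

lemma comb_smult: "x \<in> carrier_vec (length \<Phi>) \<Longrightarrow> comb \<Phi> (c \<cdot>\<^sub>v x) = fscale c (comb \<Phi> x)"
  by (simp add: comb_def fun_eq_iff sum_distrib_left mult.assoc)

context two_level_setting
begin

definition nodal_list :: "(real ^ 'd) list \<Rightarrow> (real ^ 'd \<Rightarrow> real) list" where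
  "nodal_list ps = map (nodal_basis_fun (fine_elems P)) ps"

lemma length_nodal_list [simp]: "length (nodal_list ps) = length ps"
  by (simp add: nodal_list_def)

lemma comb_V_h0: "(\<And>k. k < length \<Phi> \<Longrightarrow> \<Phi> ! k \<in> V_h0 P) \<Longrightarrow> comb \<Phi> x \<in> V_h0 P"
  unfolding comb_def by (rule V_h0_lincomb) simp

lemma gram_at_form:
  assumes \<Phi>: "\<And>k. k < length \<Phi> \<Longrightarrow> \<Phi> ! k \<in> V_h0 P"
    and x: "x \<in> carrier_vec (length \<Phi>)" and y: "y \<in> carrier_vec (length \<Phi>)"
  shows "y \<bullet> ((gram (L2_form P) \<Phi> + dt \<cdot>\<^sub>m gram (a_form P) \<Phi>) *\<^sub>v x) = at_form P dt (comb \<Phi> x) (comb \<Phi> y)"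
proof -
  let ?b = "at_form P dt" and ?n = "length \<Phi>"
  have yV: "comb \<Phi> y \<in> V_h P" and \<Phi>V: "\<And>k. k < ?n \<Longrightarrow> \<Phi> ! k \<in> V_h P"
    using comb_V_h0[OF \<Phi>] \<Phi> V_h0_V_h by blast+
  have "?b (comb \<Phi> x) (comb \<Phi> y) = (\<Sum>l<?n. x $ l * ?b (\<Phi> ! l) (comb \<Phi> y))"
    unfolding comb_def[of \<Phi> x] using at_form_lincomb[OF yV, where I = "{..<?n}" and f = "(!) \<Phi>"] \<Phi> by simp
  also have "\<dots> = (\<Sum>l<?n. x $ l * (\<Sum>k<?n. y $ k * ?b (\<Phi> ! l) (\<Phi> ! k)))"
  proof (rule sum.cong[OF refl])
    fix l assume l: "l \<in> {..<?n}"
    have "?b (\<Phi> ! l) (comb \<Phi> y) = ?b (comb \<Phi> y) (\<Phi> ! l)" by (rule at_form_sym)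
    also have "\<dots> = (\<Sum>k<?n. y $ k * ?b (\<Phi> ! k) (\<Phi> ! l))"
      unfolding comb_def using at_form_lincomb[OF \<Phi>V, where I = "{..<?n}" and f = "(!) \<Phi>"] \<Phi> l by simp
    finally show "x $ l * ?b (\<Phi> ! l) (comb \<Phi> y) = x $ l * (\<Sum>k<?n. y $ k * ?b (\<Phi> ! l) (\<Phi> ! k))"
      by (simp add: at_form_sym)
  qed
  also have "\<dots> = (\<Sum>k<?n. y $ k * (\<Sum>l<?n. ?b (\<Phi> ! l) (\<Phi> ! k) * x $ l))"
    unfolding sum_distrib_left by (subst sum.swap) (simp add: ac_simps)
  also have "\<dots> = y \<bullet> ((gram (L2_form P) \<Phi> + dt \<cdot>\<^sub>m gram (a_form P) \<Phi>) *\<^sub>v x)"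
    using x y by (simp add: scalar_prod_def gram_def at_form_def lessThan_atLeast0 row_def add.commute)
  finally show ?thesis by simp
qed

end

section \<open>Coordinates with respect to the interior vertices\<close>

locale discrete_setting = two_level_setting \<eta>\<^sub>0 C\<^sub>P C\<^sub>I C\<^sub>\<chi> m P
  for \<eta>\<^sub>0 C\<^sub>P C\<^sub>I C\<^sub>\<chi> m and P :: "(real ^ 'd) two_level" +
  fixes ps :: "(real ^ 'd) list"
  assumes ps: "is_interior_vertex_list P ps"
begin

lemma nodal_V_h0: "k < length ps \<Longrightarrow> nodal_list ps ! k \<in> V_h0 P"
proof -
  assume k: "k < length ps"
  then have p: "ps ! k \<in> \<Omega> P" using ps nth_mem unfolding is_interior_vertex_list_def by blast
  let ?v = "nodal_basis_fun (fine_elems P) (ps ! k)"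
  have P1: "?v \<in> P1 (fine_elems P)" unfolding nodal_basis_fun_def by (rule nodal_interpolant_P1[OF tri])
  have "?v x = 0" if "x \<notin> \<Omega> P" for x
  \<comment> \<open>Applied to the whole mesh, whose interior is the domain: the basis function is
    zero at every vertex but one, and that one is interior.\<close>
  proof (rule P1_vanishes_outside[OF tri subset_refl P1])
    show "x \<notin> interior (\<Union>(fine_elems P))" using that fine_mesh(3) by simp
    fix q assume q: "q \<in> vertices (fine_elems P)" "q \<notin> interior (\<Union>(fine_elems P))"
    then have "q \<noteq> ps ! k" using p fine_mesh(3) by auto
    then show "?v q = 0" unfolding nodal_basis_fun_def using nodal_interpolant_vertex[OF tri q(1)] by simp
  qed
  then show ?thesis using P1 k by (simp add: V_h0_iff V_h_def nodal_list_def)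
qed

lemma nodal_value: "k < length ps \<Longrightarrow> l < length ps \<Longrightarrow> (nodal_list ps ! k) (ps ! l) = (if k = l then 1 else 0)"
proof -
  assume kl: "k < length ps" "l < length ps"
  then have "ps ! l \<in> vertices (fine_elems P)" "distinct ps"
    using ps nth_mem unfolding is_interior_vertex_list_def by blast+
  then show ?thesis using kl
    by (simp add: nodal_list_def nodal_basis_fun_def nodal_interpolant_vertex[OF tri] nth_eq_iff_index_eq)
qed

abbreviation fn :: "real Matrix.vec \<Rightarrow> real ^ 'd \<Rightarrow> real" where
  "fn \<equiv> comb (nodal_list ps)"

lemma fn_V_h0: "fn x \<in> V_h0 P"
  by (rule comb_V_h0) (simp add: nodal_V_h0)

lemma fn_value: "k < length ps \<Longrightarrow> fn x (ps ! k) = x $ k"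
proof -
  assume k: "k < length ps"
  then have "fn x (ps ! k) = (\<Sum>l<length ps. if l = k then x $ l else 0)"
    unfolding comb_def by (intro sum.cong) (auto simp: nodal_value)
  then show ?thesis using k by simp
qed

lemma V_h0_eqI:
  assumes u: "u \<in> V_h0 P" and v: "v \<in> V_h0 P" and eq: "\<And>k. k < length ps \<Longrightarrow> u (ps ! k) = v (ps ! k)"
  shows "u = v"
proof (rule P1_ext[OF tri])
  show "u \<in> P1 (fine_elems P)" "v \<in> P1 (fine_elems P)"
    using V_h0_V_h[OF u] V_h0_V_h[OF v] by (simp_all add: V_h_def)
  fix q assume q: "q \<in> vertices (fine_elems P)"
  show "u q = v q"
  proof (cases "q \<in> \<Omega> P")
    case True
    then obtain k where "k < length ps" "q = ps ! k"
      using q ps unfolding is_interior_vertex_list_def by (metis IntI in_set_conv_nth)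
    then show ?thesis using eq by simp
  next
    case False
    then show ?thesis using V_h0_zero_outside[OF u] V_h0_zero_outside[OF v] by simp
  qed
qed

text \<open>Nodal coordinates are vertex values, so the columns of the inclusion matrix are the
  coordinate vectors of the basis functions.\<close>

lemma inclusion_fn:
  assumes b: "\<And>j. j < length b \<Longrightarrow> b ! j \<in> V_h0 P" and y: "y \<in> carrier_vec (length b)"
  shows "fn (inclusion_mat ps b *\<^sub>v y) = comb b y"
proof (rule V_h0_eqI[OF fn_V_h0 comb_V_h0[OF b]])
  fix k assume k: "k < length ps"
  then have "fn (inclusion_mat ps b *\<^sub>v y) (ps ! k) = (inclusion_mat ps b *\<^sub>v y) $ k" by (rule fn_value)
  also have "\<dots> = comb b y (ps ! k)"
    using k y by (simp add: inclusion_mat_def scalar_prod_def comb_def lessThan_atLeast0 mult.commute)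
  finally show "fn (inclusion_mat ps b *\<^sub>v y) (ps ! k) = comb b y (ps ! k)" .
qed auto

lemma fn_nonzero: "x \<in> carrier_vec (length ps) \<Longrightarrow> x \<noteq> 0\<^sub>v (length ps) \<Longrightarrow> fn x \<noteq> 0"
proof
  assume x: "x \<in> carrier_vec (length ps)" "x \<noteq> 0\<^sub>v (length ps)" and "fn x = 0"
  then have "x $ k = 0" if "k < length ps" for k using fn_value[OF that, of x] by simp
  then have "x = 0\<^sub>v (length ps)" using x(1) by (intro eq_vecI) auto
  then show False using x(2) by simp
qed

abbreviation system_mat :: "real \<Rightarrow> real mat" where
  "system_mat dt \<equiv> mass P ps + dt \<cdot>\<^sub>m stiffness P ps"

lemma mats: "mass P ps \<in> carrier_mat (length ps) (length ps)" "stiffness P ps \<in> carrier_mat (length ps) (length ps)"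
  by (simp_all add: mass_def stiffness_def gram_def)

lemma system_form:
  "x \<in> carrier_vec (length ps) \<Longrightarrow> y \<in> carrier_vec (length ps) \<Longrightarrow>
    y \<bullet> (system_mat dt *\<^sub>v x) = at_form P dt (fn x) (fn y)"
  using gram_at_form[of "nodal_list ps" x y dt] nodal_V_h0
  by (simp add: mass_def stiffness_def nodal_list_def)

text \<open>The Galerkin equations for vectors become orthogonality for functions: each summand of
  the preconditioner, multiplied by the system matrix, is the energy projection onto
  \<open>V_sub P i\<close>, whichever basis was chosen.\<close>

lemma subspace_projection:
  assumes dt: "0 < dt" and i: "i \<in> {0..N P}" and b: "is_basis b (V_sub P i)"
  defines "B \<equiv> subspace_solve dt (mass P ps) (stiffness P ps) (inclusion_mat ps b)"
  shows "B \<in> carrier_mat (length ps) (length ps)"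
    and "x \<in> carrier_vec (length ps) \<Longrightarrow> fn (B *\<^sub>v (system_mat dt *\<^sub>v x)) \<in> V_sub P i"
    and "x \<in> carrier_vec (length ps) \<Longrightarrow> v \<in> V_sub P i \<Longrightarrow>
      at_form P dt (fn (B *\<^sub>v (system_mat dt *\<^sub>v x))) v = at_form P dt (fn x) v"
proof -
  let ?n = "length ps" and ?r = "length b" and ?R = "inclusion_mat ps b"
  have dist: "distinct b" and ind: "\<not> fun_vs.dependent (set b)" and span: "fun_vs.span (set b) = V_sub P i"
    using b by (auto simp: is_basis_def)
  have bV: "b ! j \<in> V_h0 P" if "j < ?r" for j
    using V_sub_V_h0[OF i] span fun_vs.span_base[of "b ! j" "set b"] nth_mem[OF that] by blast
  have comb_sub: "comb b y \<in> V_sub P i" for y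
    unfolding span[symmetric] span_eq_range_sum[OF dist] comb_def by (rule range_eqI[of _ _ "\<lambda>j. y $ j"]) (rule refl)
  have sub_comb: "\<exists>y\<in>carrier_vec ?r. v = comb b y" if v: "v \<in> V_sub P i" for v
  proof -
    obtain u where u: "v = (\<lambda>z. \<Sum>j<?r. u j * (b ! j) z)"
      using v unfolding span[symmetric] span_eq_range_sum[OF dist] by blast
    show ?thesis by (rule bexI[of _ "Matrix.vec ?r u"]) (auto simp: comb_def u)
  qed
  have R: "?R \<in> carrier_mat ?n ?r" by (simp add: inclusion_mat_def)
  have pos: "0 < x \<bullet> (system_mat dt *\<^sub>v x)" if "x \<in> carrier_vec ?n" "x \<noteq> 0\<^sub>v ?n" for x
    using that by (simp add: system_form at_form_pos[OF dt V_h0_V_h[OF fn_V_h0] fn_nonzero])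
  have inj: "y = 0\<^sub>v ?r" if y: "y \<in> carrier_vec ?r" "?R *\<^sub>v y = 0\<^sub>v ?n" for y
  proof -
    have "comb b y = fn (0\<^sub>v ?n)" using inclusion_fn[OF bV y(1)] y(2) by simp
    also have "\<dots> = 0" by (simp add: comb_def fun_eq_iff)
    finally have "y $ j = 0" if "j < ?r" for j
      using independent_sum_zero[OF dist ind, of "\<lambda>j. y $ j" j] that by (simp add: comb_def)
    then show ?thesis using y(1) by (intro eq_vecI) auto
  qed
  show "B \<in> carrier_mat ?n ?n"
    unfolding B_def by (rule subspace_solve(1)[OF mats R]) (fact pos, fact inj)
  assume x: "x \<in> carrier_vec ?n"
  obtain y where y: "y \<in> carrier_vec ?r" "B *\<^sub>v (system_mat dt *\<^sub>v x) = ?R *\<^sub>v y"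
    and orth: "\<forall>y'\<in>carrier_vec ?r. (?R *\<^sub>v y') \<bullet> (system_mat dt *\<^sub>v (?R *\<^sub>v y)) = (?R *\<^sub>v y') \<bullet> (system_mat dt *\<^sub>v x)"
    using subspace_solve(2)[OF mats R pos inj x] unfolding B_def by blast
  show "fn (B *\<^sub>v (system_mat dt *\<^sub>v x)) \<in> V_sub P i"
    using comb_sub[of y] inclusion_fn[OF bV y(1)] y(2) by simp
  assume "v \<in> V_sub P i"
  then obtain y' where y': "y' \<in> carrier_vec ?r" "v = comb b y'" using sub_comb by blast
  have carr: "?R *\<^sub>v y \<in> carrier_vec ?n" "?R *\<^sub>v y' \<in> carrier_vec ?n" using R y y' by auto
  have v: "v = fn (?R *\<^sub>v y')" using inclusion_fn[OF bV y'(1)] y'(2) by simp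
  have "at_form P dt (fn (?R *\<^sub>v y)) v = (?R *\<^sub>v y') \<bullet> (system_mat dt *\<^sub>v (?R *\<^sub>v y))"
    unfolding v by (rule system_form[OF carr, symmetric])
  also have "\<dots> = (?R *\<^sub>v y') \<bullet> (system_mat dt *\<^sub>v x)" using orth y'(1) by blast
  also have "\<dots> = at_form P dt (fn x) v" unfolding v by (rule system_form[OF x carr(2)])
  finally show "at_form P dt (fn (B *\<^sub>v (system_mat dt *\<^sub>v x))) v = at_form P dt (fn x) v"
    unfolding y(2) .
qed

lemma preconditioner_mult:
  fixes B :: "nat \<Rightarrow> real mat"
  assumes B: "\<And>i. i \<in> {0..N P} \<Longrightarrow> B i \<in> carrier_mat (length ps) (length ps)"
    and g: "g \<in> carrier_vec (length ps)"
  shows "fn ((B 0 + Matrix.mat (length ps) (length ps) (\<lambda>(k, l). \<Sum>i\<in>{1..N P}. B i $$ (k, l))) *\<^sub>v g)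
    = (\<lambda>z. \<Sum>i\<in>{0..N P}. fn (B i *\<^sub>v g) z)"
proof (rule V_h0_eqI[OF fn_V_h0])
  let ?n = "length ps"
  show "(\<lambda>z. \<Sum>i\<in>{0..N P}. fn (B i *\<^sub>v g) z) \<in> V_h0 P"
    using V_h0_lincomb[of "{0..N P}" "\<lambda>i. fn (B i *\<^sub>v g)" "\<lambda>_. 1"] fn_V_h0 by simp
  fix k assume k: "k < ?n"
  have Bk: "(B i *\<^sub>v g) $ k = (\<Sum>l<?n. B i $$ (k, l) * g $ l)" if "i \<in> {0..N P}" for i
    using B[OF that] g k by (simp add: scalar_prod_def lessThan_atLeast0)
  have split: "{0..N P} = insert 0 {1..N P}" by auto
  have "((B 0 + Matrix.mat ?n ?n (\<lambda>(k, l). \<Sum>i\<in>{1..N P}. B i $$ (k, l))) *\<^sub>v g) $ k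
      = (\<Sum>l<?n. (B 0 $$ (k, l) + (\<Sum>i\<in>{1..N P}. B i $$ (k, l))) * g $ l)"
    using B[of 0] g k by (simp add: scalar_prod_def lessThan_atLeast0)
  also have "\<dots> = (\<Sum>l<?n. \<Sum>i\<in>{0..N P}. B i $$ (k, l) * g $ l)"
    by (simp add: split sum_distrib_right distrib_right sum.distrib)
  also have "\<dots> = (\<Sum>i\<in>{0..N P}. (B i *\<^sub>v g) $ k)"
    by (subst sum.swap) (simp add: Bk)
  finally show "fn ((B 0 + Matrix.mat ?n ?n (\<lambda>(k, l). \<Sum>i\<in>{1..N P}. B i $$ (k, l))) *\<^sub>v g) (ps ! k)
      = (\<Sum>i\<in>{0..N P}. fn (B i *\<^sub>v g) (ps ! k))"
    using k by (simp add: fn_value)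
qed

lemma preconditioned_spectrum:
  assumes dt: "0 < dt"
    and I0: "linear_operator (V_h0 P) (V_0 P) I\<^sub>0"
    and C0: "\<forall>u\<in>V_h0 P. form_norm (at_form P dt) (I\<^sub>0 u) \<le> C\<^sub>0 * form_norm (at_form P dt) u"
    and CA: "\<forall>u\<in>V_h0 P. s_form P (u - I\<^sub>0 u) (u - I\<^sub>0 u) \<le> C\<^sub>A * a_form P (u - I\<^sub>0 u) (u - I\<^sub>0 u)"
    and bs: "\<forall>i\<in>{0..N P}. is_basis (bs i) (V_sub P i)"
  defines "T \<equiv> preconditioner P dt ps bs * system_mat dt" and "C \<equiv> stability_const C\<^sub>0 C\<^sub>A"
  shows "spectrum (map_mat complex_of_real T) \<subseteq> complex_of_real ` {0<..}"
    and "cond T \<le> max 1 ((real m + 1) * C)"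
proof -
  let ?n = "length ps" and ?b = "at_form P dt" and ?J = "{0..N P}"
  define B where "B i = subspace_solve dt (mass P ps) (stiffness P ps) (inclusion_mat ps (bs i))" for i
  note proj = subspace_projection[OF dt _ bs[rule_format], folded B_def]
  have G: "system_mat dt \<in> carrier_mat ?n ?n" using mats by simp
  define Q where "Q = B 0 + Matrix.mat ?n ?n (\<lambda>(k, l). \<Sum>i\<in>{1..N P}. B i $$ (k, l))"
  have Q: "Q \<in> carrier_mat ?n ?n" unfolding Q_def using proj(1)[of 0] by simp
  have T: "T = Q * system_mat dt"
    by (simp add: T_def Q_def preconditioner_def Let_def B_def)
  have Tc: "T \<in> carrier_mat ?n ?n" unfolding T using Q G by simp
  define p where "p x i = fn (B i *\<^sub>v (system_mat dt *\<^sub>v x))" for x i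
  have p: "p x i \<in> V_sub P i" and orth: "\<And>v. v \<in> V_sub P i \<Longrightarrow> ?b (p x i) v = ?b (fn x) v"
    if "x \<in> carrier_vec ?n" "i \<in> ?J" for x i
    using proj(2,3)[OF that(2,2) that(1)] by (simp_all add: p_def)
  have Tx: "fn (T *\<^sub>v x) = (\<lambda>z. \<Sum>i\<in>?J. p x i z)" if x: "x \<in> carrier_vec ?n" for x
  proof -
    have "T *\<^sub>v x = Q *\<^sub>v (system_mat dt *\<^sub>v x)" unfolding T using Q G x by (rule assoc_mult_mat_vec)
    then show ?thesis
      unfolding p_def Q_def using preconditioner_mult[of B "system_mat dt *\<^sub>v x"] proj(1) G x by simp
  qed
  have V: "fn x \<in> V_h P" for x using V_h0_V_h[OF fn_V_h0] .
  \<comment> \<open>Orthogonality is used once more to project the second argument. The right-hand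
    side is symmetric in \<open>x\<close> and \<open>y\<close>, which gives selfadjointness; for
    equal arguments it is the numerator of the quotient to be bounded.\<close>
  have bT: "?b (fn (T *\<^sub>v x)) (fn y) = (\<Sum>i\<in>?J. ?b (p x i) (p y i))"
    if x: "x \<in> carrier_vec ?n" and y: "y \<in> carrier_vec ?n" for x y
  proof -
    have "?b (fn (T *\<^sub>v x)) (fn y) = (\<Sum>i\<in>?J. ?b (p x i) (fn y))"
      unfolding Tx[OF x] using V_sub_V_h0 p[OF x] by (intro at_form_sum V) auto
    also have "\<dots> = (\<Sum>i\<in>?J. ?b (p x i) (p y i))"
      using orth[OF y] p[OF x] at_form_sym by (intro sum.cong) metis+
    finally show ?thesis .
  qed
  have Cpos: "0 < C" unfolding C_def by (rule stability_const_pos)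
  have lower: "?b (fn x) (fn x) \<le> C * ?b (fn (T *\<^sub>v x)) (fn x)" if x: "x \<in> carrier_vec ?n" for x
  proof -
    let ?u = "fn x"
    have "form_norm ?b (I\<^sub>0 ?u) \<le> C\<^sub>0 * form_norm ?b ?u" using C0 fn_V_h0 by blast
    then have "(form_norm ?b (I\<^sub>0 ?u))\<^sup>2 \<le> (C\<^sub>0 * form_norm ?b ?u)\<^sup>2"
      by (intro power_mono) (simp_all add: form_norm_def at_form_nonneg[OF dt])
    then have 1: "?b (I\<^sub>0 ?u) (I\<^sub>0 ?u) \<le> C\<^sub>0\<^sup>2 * ?b ?u ?u"
      by (simp add: form_norm_def power_mult_distrib at_form_nonneg[OF dt])
    have 2: "I\<^sub>0 ?u \<in> V_sub P 0" using I0 fn_V_h0 by (auto simp: linear_operator_def V_sub_def)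
    obtain f where f: "\<And>i. i \<in> ?J \<Longrightarrow> f i \<in> V_sub P i" "?u = (\<lambda>z. \<Sum>i\<in>?J. f i z)"
      "(\<Sum>i\<in>?J. ?b (f i) (f i)) \<le> C * ?b ?u ?u"
      using stable_decomposition[OF dt fn_V_h0 2 1 CA[rule_format, OF fn_V_h0]] unfolding C_def by blast
    show ?thesis
      unfolding bT[OF x x] using p[OF x] orth[OF x] f Cpos by (intro projections_lower[OF dt fn_V_h0]) auto
  qed
  have upper: "?b (fn (T *\<^sub>v x)) (fn x) \<le> (real m + 1) * ?b (fn x) (fn x)" if x: "x \<in> carrier_vec ?n" for x
    unfolding bT[OF x x] using p[OF x] orth[OF x] by (intro projections_upper[OF dt fn_V_h0]) auto
  have "spectrum (map_mat complex_of_real T) \<subseteq> complex_of_real ` {1 / C..real m + 1} \<and>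
     spectrum T \<subseteq> {1 / C..real m + 1}"
  proof (rule spectrum_real_selfadjoint[OF Tc, where e = "\<lambda>x y. ?b (fn x) (fn y)"])
    show "?b (fn x) (fn y) = ?b (fn y) (fn x)" for x y by (rule at_form_sym)
    show "?b (fn (x + y)) (fn z) = ?b (fn x) (fn z) + ?b (fn y) (fn z)"
      if "x \<in> carrier_vec ?n" "y \<in> carrier_vec ?n" for x y z
      using that by (simp only: comb_add length_nodal_list at_form_add V)
    show "?b (fn (c \<cdot>\<^sub>v x)) (fn y) = c * ?b (fn x) (fn y)" if "x \<in> carrier_vec ?n" for c x y
      using that by (simp only: comb_smult length_nodal_list at_form_scale V)
    show "0 < ?b (fn x) (fn x)" if "x \<in> carrier_vec ?n" "x \<noteq> 0\<^sub>v ?n" for x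
      using that by (intro at_form_pos dt V fn_nonzero)
    show "?b (fn (T *\<^sub>v x)) (fn y) = ?b (fn x) (fn (T *\<^sub>v y))"
      if "x \<in> carrier_vec ?n" "y \<in> carrier_vec ?n" for x y
    proof -
      have "?b (fn x) (fn (T *\<^sub>v y)) = ?b (fn (T *\<^sub>v y)) (fn x)" by (rule at_form_sym)
      also have "\<dots> = (\<Sum>i\<in>?J. ?b (p y i) (p x i))" by (rule bT[OF that(2,1)])
      also have "\<dots> = (\<Sum>i\<in>?J. ?b (p x i) (p y i))" by (intro sum.cong refl at_form_sym)
      also have "\<dots> = ?b (fn (T *\<^sub>v x)) (fn y)" by (rule bT[OF that, symmetric])
      finally show ?thesis by (rule sym)
    qed
    show "1 / C * ?b (fn x) (fn x) \<le> ?b (fn (T *\<^sub>v x)) (fn x)" if "x \<in> carrier_vec ?n" for x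
      using lower[OF that] Cpos by (simp add: field_simps)
    show "?b (fn (T *\<^sub>v x)) (fn x) \<le> (real m + 1) * ?b (fn x) (fn x)" if "x \<in> carrier_vec ?n" for x
      using upper[OF that] .
  qed
  then have spec: "spectrum (map_mat complex_of_real T) \<subseteq> complex_of_real ` {1 / C..real m + 1}"
     "spectrum T \<subseteq> {1 / C..real m + 1}" by blast+
  have "{1 / C..real m + 1} \<subseteq> {0<..}" using Cpos by (auto intro: less_le_trans[of 0 "1 / C"])
  then show "spectrum (map_mat complex_of_real T) \<subseteq> complex_of_real ` {0<..}" using spec(1) by blast
  have "cond T \<le> max 1 ((real m + 1) / (1 / C))" using Cpos by (intro cond_le[OF Tc _ spec]) simp
  then show "cond T \<le> max 1 ((real m + 1) * C)" by simp
qed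

end

theorem theorem7:
  fixes C\<^sub>0 C\<^sub>A \<eta>\<^sub>0 C\<^sub>P C\<^sub>I C\<^sub>\<chi> :: real and m :: nat
  assumes dim: "CARD('d::finite) = 2 \<or> CARD('d) = 3"
  shows "\<exists>C. \<forall>(P :: (real ^ 'd) two_level) I\<^sub>0 dt ps bs.
    two_level_setting \<eta>\<^sub>0 C\<^sub>P C\<^sub>I C\<^sub>\<chi> m P \<longrightarrow>
    0 < dt \<longrightarrow>
    linear_operator (V_h0 P) (V_0 P) I\<^sub>0 \<longrightarrow>
    (\<forall>u\<in>V_h0 P. form_norm (at_form P dt) (I\<^sub>0 u) \<le> C\<^sub>0 * form_norm (at_form P dt) u) \<longrightarrow>
    (\<forall>u\<in>V_h0 P. s_form P (u - I\<^sub>0 u) (u - I\<^sub>0 u) \<le> C\<^sub>A * a_form P (u - I\<^sub>0 u) (u - I\<^sub>0 u)) \<longrightarrow>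
    is_interior_vertex_list P ps \<longrightarrow>
    (\<forall>i\<in>{0..N P}. is_basis (bs i) (V_sub P i)) \<longrightarrow>
    (let T = preconditioner P dt ps bs * (mass P ps + dt \<cdot>\<^sub>m stiffness P ps)
     in spectrum (map_mat complex_of_real T) \<subseteq> complex_of_real ` {0<..} \<and> cond T \<le> C)"
proof -
  \<comment> \<open>The value of \<open>stability_const\<close> is written out because the witness
    has to be chosen before \<open>P\<close>, hence outside the locale; it visibly depends on the
    given constants and the dimension only.\<close>
  let ?C = "C\<^sub>0\<^sup>2 + 2 * (1 + C\<^sub>0\<^sup>2) * (2 * C\<^sub>I\<^sup>2 * (1 + real m * C\<^sub>\<chi>\<^sup>2 * \<bar>C\<^sub>A\<bar>) + 4 ^ (CARD('d) + 1))"
  show ?thesis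
  proof (rule exI[of _ "max 1 ((real m + 1) * ?C)"], intro allI impI)
    fix P :: "(real ^ 'd) two_level" and I\<^sub>0 dt ps bs
    assume setting: "two_level_setting \<eta>\<^sub>0 C\<^sub>P C\<^sub>I C\<^sub>\<chi> m P" and dt: "0 < dt"
      and I0: "linear_operator (V_h0 P) (V_0 P) I\<^sub>0"
      and C0: "\<forall>u\<in>V_h0 P. form_norm (at_form P dt) (I\<^sub>0 u) \<le> C\<^sub>0 * form_norm (at_form P dt) u"
      and CA: "\<forall>u\<in>V_h0 P. s_form P (u - I\<^sub>0 u) (u - I\<^sub>0 u) \<le> C\<^sub>A * a_form P (u - I\<^sub>0 u) (u - I\<^sub>0 u)"
      and ps: "is_interior_vertex_list P ps"
      and bs: "\<forall>i\<in>{0..N P}. is_basis (bs i) (V_sub P i)"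
    interpret discrete_setting \<eta>\<^sub>0 C\<^sub>P C\<^sub>I C\<^sub>\<chi> m P ps
      using setting ps by (simp add: discrete_setting_def discrete_setting_axioms_def)
    show "let T = preconditioner P dt ps bs * (mass P ps + dt \<cdot>\<^sub>m stiffness P ps)
     in spectrum (map_mat complex_of_real T) \<subseteq> complex_of_real ` {0<..} \<and> cond T \<le> max 1 ((real m + 1) * ?C)"
      using preconditioned_spectrum[OF dt I0 C0 CA bs] unfolding stability_const_def by (simp add: Let_def)
  qed
qed

end
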